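(* Let $(G,u)$ be a concurrent game with state space $S$ and let $\Pi$ be a partition of $S$ such that the lower and upper abstractions $(G^{\downarrow},u^{\downarrow})$ and $(G^{\uparrow},u^{\uparrow})$ of $(G,u)$ with respect to $\Pi$ exist. Then the abstraction is sound: for all $L\in\mathbb N$, $$\upsilon_{2L}(G^{\downarrow},u^{\downarrow})\le\upsilon_{L}(G,u)\le\upsilon_{2L}(G^{\uparrow},u^{\uparrow}).$$
   Context: **Concurrent games.** A concurrent two-player game structure is $G=(S,s_0,A,\Gamma_1,\Gamma_2,\delta)$, where $S$ is a finite set of states, $s_0\in S$ the start state, $A$ a finite set of actions, $\Gamma_1,\Gamma_2:S\to 2^A\setminus\{\emptyset\}$ give the actions available to each player at each state, and $\delta:S\times A\times A\to S$ is the transition function (relevant for $a_1\in\Gamma_1(s)$, $a_2\in\Gamma_2(s)$). A game $(G,u)$ is a game structure with a utility function $u:S\to\mathbb R$ for player 1, who maximizes; player 2 minimizes. A play is an infinite sequence $(s_i,a_1^i,a_2^i)_{i\ge0}$ starting at $s_0$ with $a_j^i\in\Gamma_j(s_i)$ and $s_{i+1}=\delta(s_i,a_1^i,a_2^i)$, actions being chosen simultaneously and independently. A history is a finite prefix of a play (a finite sequence of triples, possibly empty); $last(h)$ is the state reached after $h$ ($s_0$ for the empty history). A mixed strategy of player $i$ maps each history $h$ to a probability distribution supported in $\Gamma_i(last(h))$. A pair of mixed strategies induces a probability measure on plays, with expectation $\mathbb E^{(\sigma_1,\sigma_2)}$. For a play $p$, $u_L(p)=\sum_{i=0}^{L-1}u(s_i)$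 is the utility of its prefix of length $L$, and the $L$-step finite-horizon value is $$\upsilon_L(G,u)=\sup_{\sigma_1}\inf_{\sigma_2}\mathbb E^{(\sigma_1,\sigma_2)}[u_L(p)],$$ over mixed strategies. **Abstractions.** Let $\Pi$ be a partition of $S$. The abstractions with respect to $\Pi$ exist if and only if any two states $s_1,s_2$ in the same set of $\Pi$ satisfy $\Gamma_1(s_1)=\Gamma_1(s_2)$ and $\Gamma_2(s_1)=\Gamma_2(s_2)$. In that case the lower abstraction $G^{\downarrow}=(S^{a},s_0^{a},A^{a},\Gamma_1^{\downarrow},\Gamma_2^{\downarrow},\delta^{\downarrow})$ and the upper abstraction $G^{\uparrow}=(S^{a},s_0^{a},A^{a},\Gamma_1^{\uparrow},\Gamma_2^{\uparrow},\delta^{\uparrow})$ are: - $S^{a}=\Pi\cup D$ with $D=\Pi\times A\times A$ (dummy states); $s_0^{a}\in\Pi$ is the set containing $s_0$; $A^{a}=A\cup\Pi$. - For $\pi\in\Pi$ and $i=1,2$: $\Gamma_i^{\downarrow}(\pi)=\Gamma_i^{\uparrow}(\pi)=\Gamma_i(s)$ for any $s\in\pi$; and $\delta^{\downarrow}(\pi,a_1,a_2)=\delta^{\uparrow}(\pi,a_1,a_2)=(\pi,a_1,a_2)\in D$ for available $a_1,a_2$. - For $d=(\pi,a_1,a_2)\in D$ let $X_d=\{\pi'\in\Pi:\exists s\in\pi,\ \delta(s,a_1,a_2)\in\pi'\}$. In $G^{\downarrow}$, $\Gamma_1^{\downarrow}(d)$ is a singleton (an arbitrary fixed action), $\Gamma_2^{\downarrow}(d)=X_d$,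 and $\delta^{\downarrow}(d,b_1,b_2)=b_2$. In $G^{\uparrow}$, $\Gamma_2^{\uparrow}(d)$ is a singleton, $\Gamma_1^{\uparrow}(d)=X_d$, and $\delta^{\uparrow}(d,b_1,b_2)=b_1$. - $u^{\downarrow}(\pi)=\min_{s\in\pi}u(s)$ and $u^{\uparrow}(\pi)=\max_{s\in\pi}u(s)$ for $\pi\in\Pi$; $u^{\downarrow}(d)=u^{\uparrow}(d)=0$ for $d\in D$. *)

theory Defs
  imports "HOL-Probability.Probability" "HOL-Library.Disjoint_Sets"
begin

record ('s, 'a) game_structure =
  states :: "'s set"
  start :: 's
  actions :: "'a set"
  avail1 :: "'s \<Rightarrow> 'a set"
  avail2 :: "'s \<Rightarrow> 'a set"
  delta :: "'s \<Rightarrow> 'a \<Rightarrow> 'a \<Rightarrow> 's"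

locale concurrent_game =
  fixes G :: "('s, 'a) game_structure"
  assumes finite_states: "finite (states G)"
    and finite_actions: "finite (actions G)"
    and start_in_states: "start G \<in> states G"
    and avail1_subset: "s \<in> states G \<Longrightarrow> avail1 G s \<subseteq> actions G"
    and avail1_nonempty: "s \<in> states G \<Longrightarrow> avail1 G s \<noteq> {}"
    and avail2_subset: "s \<in> states G \<Longrightarrow> avail2 G s \<subseteq> actions G"
    and avail2_nonempty: "s \<in> states G \<Longrightarrow> avail2 G s \<noteq> {}"
    and delta_in_states:
      "s \<in> states G \<Longrightarrow> a1 \<in> actions G \<Longrightarrow> a2 \<in> actions G \<Longrightarrow> delta G s a1 a2 \<in> states G"

type_synonym ('s, 'a) step = "'s \<times> 'a \<times> 'a"
type_synonym ('s, 'a) history = "('s, 'a) step list"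
type_synonym ('s, 'a) play = "('s, 'a) step stream"
type_synonym ('s, 'a) strategy = "('s, 'a) history \<Rightarrow> 'a pmf"

definition step_target :: "('s, 'a) game_structure \<Rightarrow> ('s, 'a) step \<Rightarrow> 's" where
  "step_target G x = (case x of (s, a1, a2) \<Rightarrow> delta G s a1 a2)"

definition plays :: "('s, 'a) game_structure \<Rightarrow> ('s, 'a) play set" where
  "plays G = {p. fst (p !! 0) = start G \<and>
     (\<forall>i. (case p !! i of (s, a1, a2) \<Rightarrow> a1 \<in> avail1 G s \<and> a2 \<in> avail2 G s) \<and>
          fst (p !! Suc i) = step_target G (p !! i))}"

definition histories :: "('s, 'a) game_structure \<Rightarrow> ('s, 'a) history set" where
  "histories G = {stake n p | n p. p \<in> plays G}"

definition last_state :: "('s, 'a) game_structure \<Rightarrow> ('s, 'a) history \<Rightarrow> 's" where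
  "last_state G h = (if h = [] then start G else step_target G (last h))"

text \<open>
  Mixed strategies are constrained on histories only; their values on other lists never matter.
\<close>

definition strategies1 :: "('s, 'a) game_structure \<Rightarrow> ('s, 'a) strategy set" where
  "strategies1 G = {\<sigma>. \<forall>h\<in>histories G. set_pmf (\<sigma> h) \<subseteq> avail1 G (last_state G h)}"

definition strategies2 :: "('s, 'a) game_structure \<Rightarrow> ('s, 'a) strategy set" where
  "strategies2 G = {\<sigma>. \<forall>h\<in>histories G. set_pmf (\<sigma> h) \<subseteq> avail2 G (last_state G h)}"

definition history_prob :: "('s, 'a) strategy \<Rightarrow> ('s, 'a) strategy \<Rightarrow> ('s, 'a) history \<Rightarrow> real" where
  "history_prob \<sigma>1 \<sigma>2 h = (\<Prod>i<length h. case h ! i of (s, a1, a2) \<Rightarrow>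
     pmf (\<sigma>1 (take i h)) a1 * pmf (\<sigma>2 (take i h)) a2)"

text \<open>
  The measure on plays induced by a pair of strategies is the one that gives every cylinder of a
  history the product of the probabilities of the actions along the history; the states along it
  are determined by the actions.
\<close>

definition is_play_measure ::
  "('s, 'a) game_structure \<Rightarrow> ('s, 'a) strategy \<Rightarrow> ('s, 'a) strategy \<Rightarrow> ('s, 'a) play measure \<Rightarrow> bool"
where
  "is_play_measure G \<sigma>1 \<sigma>2 M \<longleftrightarrow>
     sets M = sets (stream_space (count_space UNIV)) \<and> prob_space M \<and>
     (\<forall>h\<in>histories G. measure M {p. stake (length h) p = h} = history_prob \<sigma>1 \<sigma>2 h)"


lemma playsD:
  assumes "p \<in> plays G"
  shows "fst (p !! 0) = start G"
    and "p !! i = (s, a1, a2) \<Longrightarrow> a1 \<in> avail1 G s \<and> a2 \<in> avail2 G s"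
    and "fst (p !! Suc i) = step_target G (p !! i)"
proof -
  have *: "fst (p !! 0) = start G \<and>
     (\<forall>i. (case p !! i of (s, a1, a2) \<Rightarrow> a1 \<in> avail1 G s \<and> a2 \<in> avail2 G s) \<and>
          fst (p !! Suc i) = step_target G (p !! i))"
    by (rule assms[unfolded plays_def mem_Collect_eq])
  show "fst (p !! 0) = start G" "fst (p !! Suc i) = step_target G (p !! i)"
    using * by (blast, blast)
  show "a1 \<in> avail1 G s \<and> a2 \<in> avail2 G s" if "p !! i = (s, a1, a2)"
    using *[THEN conjunct2, rule_format, of i, THEN conjunct1] that by simp
qed

lemma stake_in_histories: "p \<in> plays G \<Longrightarrow> stake n p \<in> histories G"
  by (auto simp: histories_def)

lemma take_in_histories:
  assumes "h \<in> histories G" shows "take i h \<in> histories G"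
proof -
  obtain n p where "h = stake n p" "p \<in> plays G"
    using assms by (auto simp: histories_def)
  then show ?thesis
    by (auto simp: take_stake intro: stake_in_histories)
qed

lemma sets_cylinder: "{p. stake (length h) p = h} \<in> sets (stream_space (count_space UNIV))"
proof -
  have "{p. stake (length h) p = h} = sstart UNIV h"
    by (auto simp: sstart_eq list_eq_iff_nth_eq)
  then show ?thesis by simp
qed

context concurrent_game
begin

lemma play_snth_states:
  assumes "p \<in> plays G"
  shows "fst (p !! i) \<in> states G"
proof (induction i)
  case 0
  then show ?case using assms start_in_states by (simp add: plays_def)
next
  case (Suc i)
  obtain s a1 a2 where x: "p !! i = (s, a1, a2)" by (cases "p !! i")
  have s: "s \<in> states G" using Suc x by simp
  have "a1 \<in> avail1 G s" "a2 \<in> avail2 G s"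
    using playsD(2)[OF assms x] by auto
  moreover have t: "fst (p !! Suc i) = delta G s a1 a2"
    using playsD(3)[OF assms, of i] x by (simp only: step_target_def prod.case)
  ultimately show ?case
    using s avail1_subset avail2_subset by (auto simp: t simp del: snth.simps intro!: delta_in_states)
qed

lemma play_snth_in:
  assumes "p \<in> plays G"
  shows "p !! i \<in> states G \<times> actions G \<times> actions G"
proof -
  obtain s a1 a2 where x: "p !! i = (s, a1, a2)" by (cases "p !! i")
  have "a1 \<in> avail1 G s" "a2 \<in> avail2 G s"
    using playsD(2)[OF assms x] by auto
  moreover have "s \<in> states G"
    using play_snth_states[OF assms, of i] x by simp
  ultimately show ?thesis
    using x avail1_subset avail2_subset by auto
qed

lemma finite_histories_length: "finite {h \<in> histories G. length h = n}"
proof (rule finite_subset)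
  show "{h \<in> histories G. length h = n} \<subseteq>
      {h. set h \<subseteq> states G \<times> actions G \<times> actions G \<and> length h = n}"
  proof (clarsimp simp: subset_iff)
    fix h s a1 a2 assume "h \<in> histories G" "(s, a1, a2) \<in> set h"
    then obtain n p where "p \<in> plays G" "(s, a1, a2) \<in> set (stake n p)"
      by (auto simp: histories_def)
    then obtain i where "p \<in> plays G" "(s, a1, a2) = p !! i"
      by (metis in_set_conv_nth length_stake stake_nth)
    then show "s \<in> states G \<and> a1 \<in> actions G \<and> a2 \<in> actions G"
      using play_snth_in[of p i] by (metis mem_Sigma_iff)
  qed
  show "finite {h. set h \<subseteq> states G \<times> actions G \<times> actions G \<and> length h = n}"
    using finite_states finite_actions by (intro finite_lists_length_eq) auto
qed

lemma last_state_stake: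
  assumes "p \<in> plays G"
  shows "last_state G (stake i p) = fst (p !! i)"
proof (cases i)
  case 0
  then show ?thesis using assms by (simp add: last_state_def plays_def)
next
  case (Suc j)
  have "fst (p !! Suc j) = step_target G (p !! j)"
    by (rule playsD(3)[OF assms])
  then show ?thesis
    by (simp add: last_state_def Suc stake_Suc del: stake.simps snth.simps)
qed

lemma history_nth:
  assumes "h \<in> histories G" "i < length h"
  shows "fst (h ! i) = last_state G (take i h)"
    and "snd (h ! i) \<in> avail1 G (last_state G (take i h)) \<times> avail2 G (last_state G (take i h))"
proof -
  obtain n p where h: "h = stake n p" and p: "p \<in> plays G"
    using assms by (auto simp: histories_def)
  have hi: "h ! i = p !! i" "take i h = stake i p"
    using assms(2) h by (auto simp: take_stake min_def)
  show "fst (h ! i) = last_state G (take i h)"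
    by (simp only: hi last_state_stake[OF p])
  show "snd (h ! i) \<in> avail1 G (last_state G (take i h)) \<times> avail2 G (last_state G (take i h))"
    unfolding hi last_state_stake[OF p] using playsD(2)[OF p, of i] by (cases "p !! i") simp
qed

lemma last_state_in_states: "h \<in> histories G \<Longrightarrow> last_state G h \<in> states G"
  unfolding histories_def using last_state_stake play_snth_states by fastforce

text \<open>
  To construct the measure, draw a pair of actions for every list independently and follow the
  play that these choices determine.
\<close>

definition choice :: "(('s, 'a) history \<Rightarrow> 'a \<times> 'a) \<Rightarrow> ('s, 'a) history \<Rightarrow> 'a \<times> 'a" where
  "choice w h = (let V = avail1 G (last_state G h) \<times> avail2 G (last_state G h) in
     if w h \<in> V then w h else SOME x. x \<in> V)"

primrec chosen_history :: "(('s, 'a) history \<Rightarrow> 'a \<times> 'a) \<Rightarrow> nat \<Rightarrow> ('s, 'a) history" where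
  "chosen_history w 0 = []"
| "chosen_history w (Suc n) =
     chosen_history w n @ [(last_state G (chosen_history w n), choice w (chosen_history w n))]"

definition chosen_play :: "(('s, 'a) history \<Rightarrow> 'a \<times> 'a) \<Rightarrow> ('s, 'a) play" where
  "chosen_play w = to_stream (\<lambda>n. last (chosen_history w (Suc n)))"

lemma chosen_play_snth:
  "chosen_play w !! n = (last_state G (chosen_history w n), choice w (chosen_history w n))"
  by (simp add: chosen_play_def to_stream_def)

lemma stake_chosen_play: "stake n (chosen_play w) = chosen_history w n"
  by (induction n) (simp_all add: stake_Suc chosen_play_snth del: stake.simps(2))

lemma last_state_chosen_history: "last_state G (chosen_history w n) \<in> states G"
  and choice_avail: "choice w (chosen_history w n) \<in>
    avail1 G (last_state G (chosen_history w n)) \<times> avail2 G (last_state G (chosen_history w n))"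
proof -
  have avail: "choice w h \<in> avail1 G (last_state G h) \<times> avail2 G (last_state G h)"
    if "last_state G h \<in> states G" for h
  proof -
    have ex: "\<exists>x. x \<in> avail1 G (last_state G h) \<times> avail2 G (last_state G h)"
      using avail1_nonempty[OF that] avail2_nonempty[OF that] by auto
    show ?thesis
      unfolding choice_def Let_def using someI_ex[OF ex] by presburger
  qed
  show *: "last_state G (chosen_history w n) \<in> states G"
  proof (induction n)
    case 0
    then show ?case by (simp add: last_state_def start_in_states)
  next
    case (Suc n)
    obtain a1 a2 where a: "choice w (chosen_history w n) = (a1, a2)" by fastforce
    have "a1 \<in> actions G" "a2 \<in> actions G"
      using avail[OF Suc] a avail1_subset[OF Suc] avail2_subset[OF Suc] by auto
    then show ?case
      using delta_in_states[OF Suc] by (simp add: last_state_def[of _ "_ @ _"] step_target_def a)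
  qed
  show "choice w (chosen_history w n) \<in>
    avail1 G (last_state G (chosen_history w n)) \<times> avail2 G (last_state G (chosen_history w n))"
    by (rule avail[OF *])
qed

lemma chosen_play_in_plays: "chosen_play w \<in> plays G"
proof -
  have 0: "fst (chosen_play w !! 0) = start G"
    by (simp only: chosen_play_snth) (simp add: last_state_def)
  have 1: "case chosen_play w !! i of (s, a1, a2) \<Rightarrow> a1 \<in> avail1 G s \<and> a2 \<in> avail2 G s" for i
    using choice_avail[of w i]
    by (cases "choice w (chosen_history w i)") (simp add: chosen_play_snth)
  have 2: "fst (chosen_play w !! Suc i) = step_target G (chosen_play w !! i)" for i
    unfolding chosen_play_snth by (simp add: last_state_def[of _ "_ @ _"])
  show ?thesis
    unfolding plays_def mem_Collect_eq by (intro conjI allI 0 1 2)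
qed

lemma chosen_history_eq_iff:
  assumes "h \<in> histories G"
  shows "chosen_history w (length h) = h \<longleftrightarrow> (\<forall>i<length h. choice w (take i h) = snd (h ! i))"
proof -
  have "chosen_history w n = take n h \<longleftrightarrow> (\<forall>i<n. choice w (take i h) = snd (h ! i))"
    if "n \<le> length h" for n
    using that
  proof (induction n)
    case (Suc n)
    have "chosen_history w (Suc n) = take (Suc n) h \<longleftrightarrow>
        chosen_history w n = take n h \<and> choice w (take n h) = snd (h ! n)"
      using Suc.prems history_nth(1)[OF assms, of n]
      by (auto simp: take_Suc_conv_app_nth prod_eq_iff)
    then show ?case
      using Suc by (auto simp: less_Suc_eq)
  qed simp
  from this[of "length h"] show ?thesis by simp
qed

lemma is_play_measure_exists:
  assumes \<sigma>1: "\<sigma>1 \<in> strategies1 G" and \<sigma>2: "\<sigma>2 \<in> strategies2 G"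
  shows "\<exists>M. is_play_measure G \<sigma>1 \<sigma>2 M \<and> (AE p in M. \<forall>n. stake n p \<in> histories G)"
proof -
  define K where "K h = measure_pmf (pair_pmf (\<sigma>1 h) (\<sigma>2 h))" for h
  define N where "N = PiM UNIV K"
  interpret product_prob_space K UNIV
    by (intro product_prob_spaceI) (simp add: K_def prob_space_measure_pmf)
  interpret N: prob_space N unfolding N_def by (rule P.prob_space_axioms)
  have space_N: "space N = UNIV"
    by (simp add: N_def space_PiM K_def)
  have cyl: "{w. chosen_history w (length h) = h} =
      prod_emb UNIV K ((\<lambda>i. take i h) ` {..<length h})
        (\<Pi>\<^sub>E g \<in> (\<lambda>i. take i h) ` {..<length h}.
          {x. choice (\<lambda>_. x) g = snd (h ! length g)})" if "h \<in> histories G" for h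
  proof -
    have ch: "choice (\<lambda>_. w g) g = choice w g" for w g
      by (simp add: choice_def)
    have emb: "prod_emb UNIV K J (\<Pi>\<^sub>E g\<in>J. X g) = {w. \<forall>g\<in>J. w g \<in> X g}" for J X
      by (auto simp: prod_emb_def K_def PiE_iff)
    show ?thesis
      unfolding chosen_history_eq_iff[OF that] emb by (auto simp: ch)
  qed
  have cyl_sets: "{w. chosen_history w (length h) = h} \<in> sets N" if "h \<in> histories G" for h
    unfolding cyl[OF that] N_def by (intro sets_PiM_I) (auto simp: K_def)
  have cyl_prob: "measure N {w. chosen_history w (length h) = h} = history_prob \<sigma>1 \<sigma>2 h"
    if h: "h \<in> histories G" for h
  proof -
    have "measure N {w. chosen_history w (length h) = h} =
        (\<Prod>g \<in> (\<lambda>i. take i h) ` {..<length h}.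
          measure (K g) {x. choice (\<lambda>_. x) g = snd (h ! length g)})"
      unfolding cyl[OF h] N_def by (intro measure_PiM_emb) (auto simp: K_def)
    also have "\<dots> = (\<Prod>i<length h. measure (K (take i h)) {x. choice (\<lambda>_. x) (take i h) = snd (h ! i)})"
      by (subst prod.reindex) (auto intro!: inj_onI prod.cong dest: arg_cong[where f=length] simp: min_def)
    also have "\<dots> = history_prob \<sigma>1 \<sigma>2 h"
      unfolding history_prob_def
    proof (intro prod.cong refl)
      fix i assume "i \<in> {..<length h}"
      then have i: "i < length h" by simp
      obtain s a1 a2 where x: "h ! i = (s, a1, a2)" by (cases "h ! i")
      let ?g = "take i h" and ?V = "avail1 G (last_state G (take i h)) \<times> avail2 G (last_state G (take i h))"
      have g: "?g \<in> histories G" by (rule take_in_histories[OF h])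
      have supp: "set_pmf (pair_pmf (\<sigma>1 ?g) (\<sigma>2 ?g)) \<subseteq> ?V"
        using \<sigma>1 \<sigma>2 g by (auto simp: strategies1_def strategies2_def)
      have "measure (K ?g) {x. choice (\<lambda>_. x) ?g = snd (h ! i)} = measure (K ?g) {(a1, a2)}"
        unfolding K_def using supp
        by (intro measure_pmf.finite_measure_eq_AE)
           (auto simp: AE_measure_pmf_iff choice_def Let_def x)
      also have "\<dots> = pmf (\<sigma>1 ?g) a1 * pmf (\<sigma>2 ?g) a2"
        by (simp add: K_def measure_pmf_single pmf_pair)
      finally show "measure (K ?g) {x. choice (\<lambda>_. x) ?g = snd (h ! i)} =
          (case h ! i of (s, a1, a2) \<Rightarrow> pmf (\<sigma>1 ?g) a1 * pmf (\<sigma>2 ?g) a2)"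
        by (simp add: x)
    qed
    finally show ?thesis .
  qed
  have meas: "chosen_play \<in> measurable N (stream_space (count_space UNIV))"
  proof (rule measurable_stream_space2)
    fix n
    have *: "(\<lambda>w. chosen_play w !! n) -` A \<inter> space N \<in> sets N" for A
    proof -
      have hist: "chosen_history w (Suc n) \<in> histories G" "length (chosen_history w (Suc n)) = Suc n" for w
        by (simp_all only: stake_chosen_play[symmetric] stake_in_histories[OF chosen_play_in_plays] length_stake)
      have "(\<lambda>w. chosen_play w !! n) -` A \<inter> space N =
          (\<Union>h \<in> {h \<in> {h \<in> histories G. length h = Suc n}. last h \<in> A}. {w. chosen_history w (length h) = h})"
        using hist by (auto simp: space_N chosen_play_def to_stream_def simp del: chosen_history.simps)
      also have "\<dots> \<in> sets N"
        using cyl_sets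
        by (intro sets.finite_UN finite_subset[OF _ finite_histories_length[of "Suc n"]]) blast+
      finally show ?thesis .
    qed
    show "(\<lambda>w. chosen_play w !! n) \<in> measurable N (count_space UNIV)"
      by (rule measurableI) (use * in simp_all)
  qed
  define M where "M = distr N (stream_space (count_space UNIV)) chosen_play"
  have "measure M {p. stake (length h) p = h} = history_prob \<sigma>1 \<sigma>2 h" if h: "h \<in> histories G" for h
  proof -
    have "measure M {p. stake (length h) p = h} = measure N (chosen_play -` {p. stake (length h) p = h} \<inter> space N)"
      unfolding M_def by (intro measure_distr meas sets_cylinder)
    also have "\<dots> = measure N {w. chosen_history w (length h) = h}"
      by (simp add: space_N vimage_def stake_chosen_play)
    finally show ?thesis
      using cyl_prob[OF h] by simp
  qed
  moreover have "prob_space M"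
    unfolding M_def by (rule N.prob_space_distr[OF meas])
  moreover have "AE p in M. \<forall>n. stake n p \<in> histories G"
  proof -
    have "AE p in M. stake n p \<in> histories G" for n
    proof -
      have "{p. stake n p \<in> histories G} =
          (\<Union>h \<in> {h \<in> histories G. length h = n}. {p. stake (length h) p = h})"
        by auto
      also have "\<dots> \<in> sets (stream_space (count_space UNIV))"
        using finite_histories_length by (intro sets.finite_UN sets_cylinder) auto
      finally show ?thesis
        unfolding M_def
        by (subst AE_distr_iff[OF meas])
           (auto simp: space_stream_space intro: stake_in_histories chosen_play_in_plays)
    qed
    then show ?thesis by (simp add: AE_all_countable)
  qed
  ultimately show ?thesis
    unfolding is_play_measure_def by (intro exI[of _ M]) (auto simp: M_def)
qed

lemma is_play_measure_AE:
  assumes \<sigma>1: "\<sigma>1 \<in> strategies1 G" and \<sigma>2: "\<sigma>2 \<in> strategies2 G"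
    and M: "is_play_measure G \<sigma>1 \<sigma>2 M"
  shows "AE p in M. \<forall>n. stake n p \<in> histories G"
proof -
  let ?C = "\<lambda>h::('s, 'a) history. {p. stake (length h) p = h}"
  let ?H = "\<lambda>n. {h \<in> histories G. length h = n}"
  have eq: "{p. stake n p \<in> histories G} = (\<Union>h \<in> ?H n. ?C h)" for n
    by auto
  have sets: "{p. stake n p \<in> histories G} \<in> sets N"
    if "is_play_measure G \<sigma>1 \<sigma>2 N" for N n
    unfolding eq using that finite_histories_length sets_cylinder
    by (intro sets.finite_UN) (auto simp: is_play_measure_def)
  have total: "measure N {p. stake n p \<in> histories G} = (\<Sum>h \<in> ?H n. history_prob \<sigma>1 \<sigma>2 h)"
    if N: "is_play_measure G \<sigma>1 \<sigma>2 N" for N n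
  proof -
    interpret prob_space N using N by (simp add: is_play_measure_def)
    have "measure N (\<Union>h \<in> ?H n. ?C h) = (\<Sum>h \<in> ?H n. measure N (?C h))"
    proof (rule finite_measure_finite_Union[OF finite_histories_length])
      show "?C ` ?H n \<subseteq> sets N"
        using N sets_cylinder by (auto simp: is_play_measure_def)
      show "disjoint_family_on ?C (?H n)"
        by (auto simp: disjoint_family_on_def)
    qed
    also have "\<dots> = (\<Sum>h \<in> ?H n. history_prob \<sigma>1 \<sigma>2 h)"
      using N by (intro sum.cong) (auto simp: is_play_measure_def)
    finally show ?thesis unfolding eq .
  qed
  obtain N where N: "is_play_measure G \<sigma>1 \<sigma>2 N" and ae: "AE p in N. \<forall>n. stake n p \<in> histories G"
    using is_play_measure_exists[OF \<sigma>1 \<sigma>2] by blast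
  interpret M: prob_space M using M by (simp add: is_play_measure_def)
  interpret N: prob_space N using N by (simp add: is_play_measure_def)
  have "AE p in M. stake n p \<in> histories G" for n
  proof -
    have "measure N {p. stake n p \<in> histories G} = 1"
      using ae by (intro N.prob_eq_1[THEN iffD2] sets[OF N]) auto
    then have "measure M {p. stake n p \<in> histories G} = 1"
      by (simp add: total[OF M] total[OF N])
    then show ?thesis
      using M.prob_eq_1[OF sets[OF M]] by simp
  qed
  then show ?thesis by (simp add: AE_all_countable)
qed

lemma ex1_play_measure:
  assumes \<sigma>1: "\<sigma>1 \<in> strategies1 G" and \<sigma>2: "\<sigma>2 \<in> strategies2 G"
  shows "\<exists>!M. is_play_measure G \<sigma>1 \<sigma>2 M"
proof -
  have "M = N" if M: "is_play_measure G \<sigma>1 \<sigma>2 M" and N: "is_play_measure G \<sigma>1 \<sigma>2 N" for M N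
  proof (rule stream_space_eq_sstart)
    let ?S = "states G \<times> actions G \<times> actions G"
    have streams: "p \<in> streams ?S" if st: "\<forall>n. stake n p \<in> histories G" for p
    proof -
      have "p !! n \<in> ?S" for n
      proof -
        obtain m q where q: "stake (Suc n) p = stake m q" "q \<in> plays G"
          using st[rule_format, of "Suc n"] unfolding histories_def mem_Collect_eq by blast
        have "m = Suc n" using arg_cong[OF q(1), of length] by simp
        then have "p !! n = q !! n"
          using q(1) by (metis lessI stake_nth)
        then show ?thesis using play_snth_in[OF q(2), of n] by simp
      qed
      then show ?thesis by (simp add: streams_iff_snth)
    qed
    show "countable ?S"
      using finite_states finite_actions by (intro countable_finite) auto
    show "prob_space M" "prob_space N"
      "sets M = sets (stream_space (count_space UNIV))"
      "sets N = sets (stream_space (count_space UNIV))"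
      using M N by (auto simp: is_play_measure_def)
    show "AE p in M. p \<in> streams ?S" "AE p in N. p \<in> streams ?S"
      using is_play_measure_AE[OF \<sigma>1 \<sigma>2 M] is_play_measure_AE[OF \<sigma>1 \<sigma>2 N] streams
      by (auto elim!: eventually_mono simp del: stake.simps)
    have val: "emeasure K (sstart ?S h) =
        (if h \<in> histories G then ennreal (history_prob \<sigma>1 \<sigma>2 h) else 0)"
      if K: "is_play_measure G \<sigma>1 \<sigma>2 K" for K h
    proof -
      interpret K: prob_space K using K by (simp add: is_play_measure_def)
      have sets_K: "sets K = sets (stream_space (count_space UNIV))"
        using K by (simp add: is_play_measure_def)
      have "emeasure K (sstart ?S h) = emeasure K (if h \<in> histories G then {p. stake (length h) p = h} else {})"
      proof (rule emeasure_eq_AE)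
        show "AE p in K. (p \<in> sstart ?S h) =
            (p \<in> (if h \<in> histories G then {p. stake (length h) p = h} else {}))"
          using is_play_measure_AE[OF \<sigma>1 \<sigma>2 K]
        proof (rule eventually_mono)
          fix p assume p: "\<forall>n. stake n p \<in> histories G"
          have "p \<in> sstart ?S h \<longleftrightarrow> stake (length h) p = h"
            by (auto simp: sstart_eq[OF streams[OF p]] list_eq_iff_nth_eq)
          then show "(p \<in> sstart ?S h) =
              (p \<in> (if h \<in> histories G then {p. stake (length h) p = h} else {}))"
            using p by (metis (mono_tags) empty_iff mem_Collect_eq)
        qed
      qed (auto simp: sets_K sets_cylinder)
      also have "\<dots> = (if h \<in> histories G then ennreal (history_prob \<sigma>1 \<sigma>2 h) else 0)"
        using K by (simp add: is_play_measure_def K.emeasure_eq_measure)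
      finally show ?thesis .
    qed
    show "emeasure M (sstart ?S h) = emeasure N (sstart ?S h)" for h
      by (simp only: val[OF M] val[OF N])
  qed
  then show ?thesis
    using is_play_measure_exists[OF \<sigma>1 \<sigma>2] by blast
qed

end

text \<open>
  \<open>THE\<close> is justified for pairs of strategies of a game by \<open>ex1_play_measure\<close>.
\<close>

definition play_measure ::
  "('s, 'a) game_structure \<Rightarrow> ('s, 'a) strategy \<Rightarrow> ('s, 'a) strategy \<Rightarrow> ('s, 'a) play measure" where
  "play_measure G \<sigma>1 \<sigma>2 = (THE M. is_play_measure G \<sigma>1 \<sigma>2 M)"

definition prefix_utility :: "('s \<Rightarrow> real) \<Rightarrow> nat \<Rightarrow> ('s, 'a) play \<Rightarrow> real" where
  "prefix_utility u L p = (\<Sum>i<L. u (fst (p !! i)))"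

definition expected_utility ::
  "('s, 'a) game_structure \<Rightarrow> ('s \<Rightarrow> real) \<Rightarrow> nat \<Rightarrow> ('s, 'a) strategy \<Rightarrow> ('s, 'a) strategy \<Rightarrow> real" where
  "expected_utility G u L \<sigma>1 \<sigma>2 = integral\<^sup>L (play_measure G \<sigma>1 \<sigma>2) (prefix_utility u L)"

text \<open>
  For a game, \<open>SUP\<close> and \<open>INF\<close> range over nonempty bounded sets of reals: at each state both players
  have an action, and the utility is bounded on the finite set of states.
\<close>

definition finite_horizon_value ::
  "('s, 'a) game_structure \<Rightarrow> ('s \<Rightarrow> real) \<Rightarrow> nat \<Rightarrow> real" where
  "finite_horizon_value G u L =
     (SUP \<sigma>1\<in>strategies1 G. INF \<sigma>2\<in>strategies2 G. expected_utility G u L \<sigma>1 \<sigma>2)"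

text \<open>
  Abstractions.  In the state set \<open>P <+> (P \<times> A \<times> A)\<close> the left summand holds the classes of the
  partition \<open>P\<close> and the right one the dummy states; likewise for the action set \<open>A <+> P\<close>.
  The fixed action of the idle player at dummy states and the transitions at unavailable actions
  are left open, so the abstractions are predicates on games: a statement about all games that
  satisfy the predicate covers every such choice.
\<close>

type_synonym ('s, 'a) abs_state = "'s set + ('s set \<times> 'a \<times> 'a)"
type_synonym ('s, 'a) abs_action = "'a + 's set"
type_synonym ('s, 'a) abs_game = "(('s, 'a) abs_state, ('s, 'a) abs_action) game_structure"

definition abstractable :: "('s, 'a) game_structure \<Rightarrow> 's set set \<Rightarrow> bool" where
  "abstractable G P \<longleftrightarrow>
     (\<forall>\<pi>\<in>P. \<forall>s1\<in>\<pi>. \<forall>s2\<in>\<pi>. avail1 G s1 = avail1 G s2 \<and> avail2 G s1 = avail2 G s2)"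

definition successor_classes ::
  "('s, 'a) game_structure \<Rightarrow> 's set set \<Rightarrow> 's set \<Rightarrow> 'a \<Rightarrow> 'a \<Rightarrow> 's set set" where
  "successor_classes G P \<pi> a1 a2 = {\<pi>' \<in> P. \<exists>s\<in>\<pi>. delta G s a1 a2 \<in> \<pi>'}"

definition abstraction_common ::
  "('s, 'a) game_structure \<Rightarrow> 's set set \<Rightarrow> ('s, 'a) abs_game \<Rightarrow> bool" where
  "abstraction_common G P H \<longleftrightarrow>
     concurrent_game H \<and>
     states H = P <+> (P \<times> actions G \<times> actions G) \<and>
     (\<exists>\<pi>\<in>P. start G \<in> \<pi> \<and> start H = Inl \<pi>) \<and>
     actions H = actions G <+> P \<and>
     (\<forall>\<pi>\<in>P. \<forall>s\<in>\<pi>. avail1 H (Inl \<pi>) = Inl ` avail1 G s \<and> avail2 H (Inl \<pi>) = Inl ` avail2 G s \<and>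
        (\<forall>a1\<in>avail1 G s. \<forall>a2\<in>avail2 G s. delta H (Inl \<pi>) (Inl a1) (Inl a2) = Inr (\<pi>, a1, a2)))"

definition lower_abstraction ::
  "('s, 'a) game_structure \<Rightarrow> ('s \<Rightarrow> real) \<Rightarrow> 's set set \<Rightarrow>
   ('s, 'a) abs_game \<Rightarrow> (('s, 'a) abs_state \<Rightarrow> real) \<Rightarrow> bool" where
  "lower_abstraction G u P H v \<longleftrightarrow>
     abstraction_common G P H \<and>
     (\<forall>\<pi>\<in>P. \<forall>a1\<in>actions G. \<forall>a2\<in>actions G.
        (\<exists>c. avail1 H (Inr (\<pi>, a1, a2)) = {c}) \<and>
        avail2 H (Inr (\<pi>, a1, a2)) = Inr ` successor_classes G P \<pi> a1 a2 \<and>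
        (\<forall>b1\<in>avail1 H (Inr (\<pi>, a1, a2)). \<forall>\<pi>'\<in>successor_classes G P \<pi> a1 a2.
           delta H (Inr (\<pi>, a1, a2)) b1 (Inr \<pi>') = Inl \<pi>') \<and>
        v (Inr (\<pi>, a1, a2)) = 0) \<and>
     (\<forall>\<pi>\<in>P. v (Inl \<pi>) = Min (u ` \<pi>))"

definition upper_abstraction ::
  "('s, 'a) game_structure \<Rightarrow> ('s \<Rightarrow> real) \<Rightarrow> 's set set \<Rightarrow>
   ('s, 'a) abs_game \<Rightarrow> (('s, 'a) abs_state \<Rightarrow> real) \<Rightarrow> bool" where
  "upper_abstraction G u P H v \<longleftrightarrow>
     abstraction_common G P H \<and>
     (\<forall>\<pi>\<in>P. \<forall>a1\<in>actions G. \<forall>a2\<in>actions G.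
        (\<exists>c. avail2 H (Inr (\<pi>, a1, a2)) = {c}) \<and>
        avail1 H (Inr (\<pi>, a1, a2)) = Inr ` successor_classes G P \<pi> a1 a2 \<and>
        (\<forall>b2\<in>avail2 H (Inr (\<pi>, a1, a2)). \<forall>\<pi>'\<in>successor_classes G P \<pi> a1 a2.
           delta H (Inr (\<pi>, a1, a2)) (Inr \<pi>') b2 = Inl \<pi>') \<and>
        v (Inr (\<pi>, a1, a2)) = 0) \<and>
     (\<forall>\<pi>\<in>P. v (Inl \<pi>) = Max (u ` \<pi>))"

lemma abstraction_common_abstractable:
  fixes G :: "('s, 'a) game_structure"
  assumes "abstraction_common G P H" shows "abstractable G P"
  unfolding abstractable_def
proof (intro ballI conjI)
  fix \<pi> s1 s2 assume \<pi>: "\<pi> \<in> P" and s: "s1 \<in> \<pi>" "s2 \<in> \<pi>"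
  have "avail1 H (Inl \<pi>) = Inl ` avail1 G s \<and> avail2 H (Inl \<pi>) = Inl ` avail2 G s"
    if "s \<in> \<pi>" for s
    using assms \<pi> that by (simp add: abstraction_common_def)
  from this[OF s(1)] this[OF s(2)]
  have "Inl ` avail1 G s1 = (Inl ` avail1 G s2 :: ('a, 's set) sum set)"
    "Inl ` avail2 G s1 = (Inl ` avail2 G s2 :: ('a, 's set) sum set)"
    by simp_all
  then show "avail1 G s1 = avail1 G s2" "avail2 G s1 = avail2 G s2"
    by (simp_all only: inj_image_eq_iff[OF inj_Inl])
qed

context concurrent_game
begin

lemma abstraction_common_exists:
  fixes D1 D2 :: "'s set \<times> 'a \<times> 'a \<Rightarrow> ('s, 'a) abs_action set"
    and t :: "'s set \<times> 'a \<times> 'a \<Rightarrow> ('s, 'a) abs_action \<Rightarrow> ('s, 'a) abs_action \<Rightarrow> 's set"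
  assumes part: "partition_on (states G) P" and abs: "abstractable G P"
    and D1: "\<And>d. d \<in> P \<times> actions G \<times> actions G \<Longrightarrow> D1 d \<subseteq> actions G <+> P \<and> D1 d \<noteq> {}"
    and D2: "\<And>d. d \<in> P \<times> actions G \<times> actions G \<Longrightarrow> D2 d \<subseteq> actions G <+> P \<and> D2 d \<noteq> {}"
    and t: "\<And>d b1 b2. t d b1 b2 \<in> P"
  shows "\<exists>H. abstraction_common G P H \<and>
    (\<forall>d. avail1 H (Inr d) = D1 d \<and> avail2 H (Inr d) = D2 d \<and>
         (\<forall>b1 b2. delta H (Inr d) b1 b2 = Inl (t d b1 b2)))"
proof -
  obtain \<pi>0 where \<pi>0: "\<pi>0 \<in> P" "start G \<in> \<pi>0"
    using start_in_states partition_onD1[OF part] by auto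
  define rep where "rep \<pi> = (SOME s. s \<in> \<pi>)" for \<pi> :: "'s set"
  have rep: "rep \<pi> \<in> \<pi>" "rep \<pi> \<in> states G" if "\<pi> \<in> P" for \<pi>
  proof -
    have "\<exists>s. s \<in> \<pi>" using partition_onD3[OF part] that by (metis ex_in_conv)
    then show "rep \<pi> \<in> \<pi>" unfolding rep_def by (rule someI_ex)
    then show "rep \<pi> \<in> states G" using partition_onD1[OF part] that by blast
  qed
  have eq: "avail1 G (rep \<pi>) = avail1 G s" "avail2 G (rep \<pi>) = avail2 G s" if "\<pi> \<in> P" "s \<in> \<pi>" for \<pi> s
    using abs rep(1)[OF that(1)] that unfolding abstractable_def by blast+
  define H where "H = \<lparr> states = P <+> (P \<times> actions G \<times> actions G), start = Inl \<pi>0,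
    actions = actions G <+> P,
    avail1 = case_sum (\<lambda>\<pi>. Inl ` avail1 G (rep \<pi>)) D1,
    avail2 = case_sum (\<lambda>\<pi>. Inl ` avail2 G (rep \<pi>)) D2,
    delta = case_sum (\<lambda>\<pi> b1 b2. case (b1, b2) of (Inl a1, Inl a2) \<Rightarrow> Inr (\<pi>, a1, a2) | _ \<Rightarrow> Inl \<pi>0)
      (\<lambda>d b1 b2. Inl (t d b1 b2)) \<rparr>"
  have "finite P"
    using finite_elements[OF finite_states part] .
  have av: "avail1 H x \<subseteq> actions H \<and> avail1 H x \<noteq> {} \<and> avail2 H x \<subseteq> actions H \<and> avail2 H x \<noteq> {}"
    if x: "x \<in> states H" for x
  proof (cases x)
    case (Inl \<pi>)
    then have "\<pi> \<in> P" using x by (auto simp: H_def)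
    note r = rep(2)[OF this]
    show ?thesis
      using avail1_subset[OF r] avail1_nonempty[OF r] avail2_subset[OF r] avail2_nonempty[OF r]
      by (auto simp: H_def Inl)
  next
    case (Inr d)
    then have "d \<in> P \<times> actions G \<times> actions G" using x by (auto simp: H_def)
    from D1[OF this] D2[OF this] show ?thesis
      by (simp add: H_def Inr)
  qed
  have "concurrent_game H"
  proof
    show "finite (states H)" "finite (actions H)" "start H \<in> states H"
      using finite_actions \<open>finite P\<close> \<pi>0 by (auto simp: H_def)
    show "delta H x b1 b2 \<in> states H"
      if "x \<in> states H" "b1 \<in> actions H" "b2 \<in> actions H" for x b1 b2
      using that \<pi>0 t by (auto simp: H_def split: sum.splits)
  qed (use av in blast)+
  moreover have "avail1 H (Inl \<pi>) = Inl ` avail1 G s" "avail2 H (Inl \<pi>) = Inl ` avail2 G s"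
    if "\<pi> \<in> P" "s \<in> \<pi>" for \<pi> s
    by (simp_all add: H_def eq[OF that])
  ultimately have "abstraction_common G P H"
    unfolding abstraction_common_def using \<pi>0 by (simp add: H_def)
  then show ?thesis
    by (intro exI[of _ H]) (simp add: H_def)
qed

lemma successor_classes_nonempty:
  assumes part: "partition_on (states G) P" and "\<pi> \<in> P" "a1 \<in> actions G" "a2 \<in> actions G"
  shows "successor_classes G P \<pi> a1 a2 \<noteq> {}"
proof -
  obtain s where s: "s \<in> \<pi>" using partition_onD3[OF part] \<open>\<pi> \<in> P\<close> by (metis ex_in_conv)
  have "s \<in> states G" using s \<open>\<pi> \<in> P\<close> partition_onD1[OF part] by blast
  then have "delta G s a1 a2 \<in> \<Union>P"
    using delta_in_states assms partition_onD1[OF part] by blast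
  then show ?thesis using s by (auto simp: successor_classes_def)
qed

lemma abstractions_exist_iff:
  assumes part: "partition_on (states G) P"
  shows "(\<exists>H v. lower_abstraction G u P H v) \<longleftrightarrow> abstractable G P"
    and "(\<exists>H v. upper_abstraction G u P H v) \<longleftrightarrow> abstractable G P"
proof -
  obtain a where a: "a \<in> actions G"
    using start_in_states avail1_subset avail1_nonempty by blast
  obtain \<pi>0 where \<pi>0: "\<pi>0 \<in> P"
    using start_in_states partition_onD1[OF part] by auto
  define X where "X = (\<lambda>(\<pi>, a1, a2). Inr ` successor_classes G P \<pi> a1 a2 :: ('s, 'a) abs_action set)"
  define t where "t b = (case b of Inr \<pi>' \<Rightarrow> if \<pi>' \<in> P then \<pi>' else \<pi>0 | Inl _ \<Rightarrow> \<pi>0)"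
    for b :: "('s, 'a) abs_action"
  have X: "X d \<subseteq> actions G <+> P \<and> X d \<noteq> {}" if "d \<in> P \<times> actions G \<times> actions G" for d
  proof -
    obtain \<pi> a1 a2 where d: "d = (\<pi>, a1, a2)" by (cases d)
    have "successor_classes G P \<pi> a1 a2 \<noteq> {}" "successor_classes G P \<pi> a1 a2 \<subseteq> P"
      using that successor_classes_nonempty[OF part] by (auto simp: d successor_classes_def)
    then show ?thesis by (auto simp: d X_def)
  qed
  have c: "{Inl a} \<subseteq> actions G <+> P \<and> {Inl a} \<noteq> {}"
    using a by auto
  have t: "t b \<in> P" for b
    using \<pi>0 by (auto simp: t_def split: sum.splits)
  have t_Inr: "t (Inr \<pi>') = \<pi>'" if "\<pi>' \<in> successor_classes G P \<pi> a1 a2" for \<pi>' \<pi> a1 a2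
    using that by (simp add: t_def successor_classes_def)
  have "\<exists>H v. lower_abstraction G u P H v" if abs: "abstractable G P"
  proof -
    obtain H where H: "abstraction_common G P H" "\<And>d. avail1 H (Inr d) = {Inl a}"
      "\<And>d. avail2 H (Inr d) = X d" "\<And>d b1 b2. delta H (Inr d) b1 b2 = Inl (t b2)"
      using abstraction_common_exists[where ?D1.0="\<lambda>_. {Inl a}" and ?D2.0=X and t="\<lambda>_ _ b2. t b2",
          OF part abs c X t] by blast
    have "lower_abstraction G u P H (case_sum (\<lambda>\<pi>. Min (u ` \<pi>)) (\<lambda>_. 0))"
      unfolding lower_abstraction_def using H by (auto simp: X_def t_Inr)
    then show ?thesis by blast
  qed
  moreover have "abstractable G P" if "lower_abstraction G u P H v" for H v
    using that unfolding lower_abstraction_def by (elim conjE) (rule abstraction_common_abstractable)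
  ultimately show "(\<exists>H v. lower_abstraction G u P H v) \<longleftrightarrow> abstractable G P"
    by iprover
  have "\<exists>H v. upper_abstraction G u P H v" if abs: "abstractable G P"
  proof -
    obtain H where H: "abstraction_common G P H" "\<And>d. avail2 H (Inr d) = {Inl a}"
      "\<And>d. avail1 H (Inr d) = X d" "\<And>d b1 b2. delta H (Inr d) b1 b2 = Inl (t b1)"
      using abstraction_common_exists[where ?D1.0=X and ?D2.0="\<lambda>_. {Inl a}" and t="\<lambda>_ b1 _. t b1",
          OF part abs X c t] by blast
    have "upper_abstraction G u P H (case_sum (\<lambda>\<pi>. Max (u ` \<pi>)) (\<lambda>_. 0))"
      unfolding upper_abstraction_def using H by (auto simp: X_def t_Inr)
    then show ?thesis by blast
  qed
  moreover have "abstractable G P" if "upper_abstraction G u P H v" for H v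
    using that unfolding upper_abstraction_def by (elim conjE) (rule abstraction_common_abstractable)
  ultimately show "(\<exists>H v. upper_abstraction G u P H v) \<longleftrightarrow> abstractable G P"
    by iprover
qed

end

end

theory Submission
  imports Defs
begin

text \<open>
  The finite-horizon value satisfies the Bellman recursion
  \<open>V (n + 1) s = u s + sup x. inf y. E [V n (\<delta> s a b)]\<close>. No minimax theorem is needed:
  for a lower bound player 1 plays a nearly optimal mixed action after every history, and for an
  upper bound player 2, who knows \<open>\<sigma>1\<close>, answers the mixed action \<open>\<sigma>1 h\<close> nearly optimally.
  Two steps of the recursion in an abstraction are then compared with one step in \<open>G\<close>: in the
  lower abstraction player 2 may resolve a dummy state by the class of the true successor, in the
  upper one player 1 may.
\<close>

section \<open>Bounded sup-inf values\<close>

text \<open>\<open>SUP\<close> and \<open>INF\<close> on reals say nothing about empty or unbounded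
  sets, so nonemptiness and one uniform bound are packaged once. The locale serves at two scales:
  mixed actions in a single round, and strategies in the whole game.\<close>

locale bounded_payoff =
  fixes X :: "'x set" and Y :: "'y set" and F :: "'x \<Rightarrow> 'y \<Rightarrow> real" and M :: real
  assumes X_nonempty: "X \<noteq> {}" and Y_nonempty: "Y \<noteq> {}"
    and bounded: "x \<in> X \<Longrightarrow> y \<in> Y \<Longrightarrow> \<bar>F x y\<bar> \<le> M"
begin

abbreviation "val \<equiv> SUP x\<in>X. INF y\<in>Y. F x y"

lemma bdd_below_payoff: "x \<in> X \<Longrightarrow> bdd_below (F x ` Y)"
  using bounded by (intro bdd_belowI2[where m="-M"]) (force simp: abs_le_iff)

lemma bdd_above_INF: "bdd_above ((\<lambda>x. INF y\<in>Y. F x y) ` X)"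
proof (rule bdd_aboveI2)
  fix x assume x: "x \<in> X"
  obtain y where y: "y \<in> Y" using Y_nonempty by blast
  have "(INF y\<in>Y. F x y) \<le> F x y" by (rule cINF_lower[OF bdd_below_payoff[OF x] y])
  also have "\<dots> \<le> M" using bounded[OF x y] by simp
  finally show "(INF y\<in>Y. F x y) \<le> M" .
qed

lemma val_ge:
  assumes "x \<in> X" "\<And>y. y \<in> Y \<Longrightarrow> c \<le> F x y"
  shows "c \<le> val"
proof -
  have "c \<le> (INF y\<in>Y. F x y)" using assms by (intro cINF_greatest Y_nonempty)
  also have "\<dots> \<le> val" by (rule cSUP_upper[OF assms(1) bdd_above_INF])
  finally show ?thesis .
qed

text \<open>The witness \<open>y\<close> may depend on \<open>x\<close>: the minimizer replies to a
  known choice. This quantifier order is what makes upper bounds provable without exchanging sup and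
  inf.\<close>

lemma val_le:
  assumes "\<And>x. x \<in> X \<Longrightarrow> \<exists>y\<in>Y. F x y \<le> c"
  shows "val \<le> c"
proof (rule cSUP_least[OF X_nonempty])
  fix x assume x: "x \<in> X"
  then obtain y where "y \<in> Y" "F x y \<le> c" using assms by blast
  then show "(INF y\<in>Y. F x y) \<le> c" using cINF_lower[OF bdd_below_payoff[OF x]] by fastforce
qed

text \<open>A supremum is approached from within the set to any positive error, so no compactness
  argument for attainment is involved; the errors are removed later by letting \<open>e\<close> tend
  to 0.\<close>

lemma ex_near_optimal:
  assumes "e > 0"
  shows "\<exists>x\<in>X. \<forall>y\<in>Y. val - e \<le> F x y"
proof -
  have "val - e < val" using assms by simp
  then obtain x where x: "x \<in> X" "val - e < (INF y\<in>Y. F x y)"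
    unfolding less_cSUP_iff[OF X_nonempty bdd_above_INF] by blast
  then have "val - e \<le> F x y" if "y \<in> Y" for y
    using cINF_lower[OF bdd_below_payoff[OF x(1)] that] by linarith
  then show ?thesis using x(1) by blast
qed

lemma ex_near_best_response:
  assumes "e > 0" "x \<in> X"
  shows "\<exists>y\<in>Y. F x y \<le> val + e"
proof -
  have "(INF y\<in>Y. F x y) < val + e"
    using cSUP_upper[OF assms(2) bdd_above_INF] assms(1) by linarith
  then show ?thesis
    unfolding cINF_less_iff[OF Y_nonempty bdd_below_payoff[OF assms(2)]] by force
qed

end

section \<open>One-step games\<close>

definition pmfs_on :: "'a set \<Rightarrow> 'a pmf set" where
  "pmfs_on A = {x. set_pmf x \<subseteq> A}"

definition payoff :: "('a \<times> 'b \<Rightarrow> real) \<Rightarrow> 'a pmf \<Rightarrow> 'b pmf \<Rightarrow> real" where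
  "payoff f x y = measure_pmf.expectation (pair_pmf x y) f"

definition matrix_value :: "'a set \<Rightarrow> 'b set \<Rightarrow> ('a \<times> 'b \<Rightarrow> real) \<Rightarrow> real" where
  "matrix_value A B f = (SUP x\<in>pmfs_on A. INF y\<in>pmfs_on B. payoff f x y)"

lemma return_pmf_in_pmfs_on: "a \<in> A \<Longrightarrow> return_pmf a \<in> pmfs_on A"
  by (simp add: pmfs_on_def)

lemma pmfs_on_nonempty: "A \<noteq> {} \<Longrightarrow> pmfs_on A \<noteq> {}"
  using return_pmf_in_pmfs_on by fastforce

lemma integrable_pair_pmf:
  fixes f :: "_ \<Rightarrow> real"
  assumes "finite A" "finite B" "x \<in> pmfs_on A" "y \<in> pmfs_on B"
  shows "integrable (measure_pmf (pair_pmf x y)) f"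
  using assms by (intro integrable_measure_pmf_finite) (auto simp: pmfs_on_def intro: finite_subset)

lemma payoff_mono:
  assumes "finite A" "finite B" "x \<in> pmfs_on A" "y \<in> pmfs_on B"
    and "\<And>a b. a \<in> A \<Longrightarrow> b \<in> B \<Longrightarrow> f (a, b) \<le> g (a, b)"
  shows "payoff f x y \<le> payoff g x y"
  unfolding payoff_def
  using assms integrable_pair_pmf[OF assms(1-4)]
  by (intro integral_mono_AE) (auto simp: AE_measure_pmf_iff pmfs_on_def)

lemma payoff_const: "payoff (\<lambda>_. c) x y = c"
  by (simp add: payoff_def)

lemma payoff_add_const:
  assumes "finite A" "finite B" "x \<in> pmfs_on A" "y \<in> pmfs_on B"
  shows "payoff (\<lambda>z. f z + c) x y = payoff f x y + c"
  unfolding payoff_def by (subst Bochner_Integration.integral_add[OF integrable_pair_pmf[OF assms]])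
    (simp_all add: integrable_pair_pmf[OF assms])

lemma payoff_abs_le:
  assumes "finite A" "finite B" "x \<in> pmfs_on A" "y \<in> pmfs_on B"
    and "\<And>a b. a \<in> A \<Longrightarrow> b \<in> B \<Longrightarrow> \<bar>f (a, b)\<bar> \<le> M"
  shows "\<bar>payoff f x y\<bar> \<le> M"
proof -
  have "payoff f x y \<le> payoff (\<lambda>_. M) x y" "payoff (\<lambda>_. -M) x y \<le> payoff f x y"
    using assms(5) by (intro payoff_mono[OF assms(1-4)]; force simp: abs_le_iff)+
  then show ?thesis by (simp add: payoff_const)
qed

text \<open>Links \<open>payoff\<close> to \<open>history_prob\<close>: the weights in this sum are
  exactly the factors by which \<open>history_prob\<close> changes when a history grows by one
  step.\<close>

lemma payoff_eq_sum:
  assumes "finite A" "finite B" "x \<in> pmfs_on A" "y \<in> pmfs_on B"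
  shows "payoff f x y = (\<Sum>(a, b)\<in>A \<times> B. pmf x a * pmf y b * f (a, b))"
proof -
  have "payoff f x y = (\<Sum>z\<in>A \<times> B. f z * pmf (pair_pmf x y) z)"
    unfolding payoff_def using assms
    by (intro integral_measure_pmf_real) (auto simp: pmfs_on_def)
  then show ?thesis
    by (auto simp: pmf_pair mult.commute intro!: sum.cong)
qed

lemma bounded_payoff_matrix:
  assumes "finite A" "finite B" "A \<noteq> {}" "B \<noteq> {}"
  shows "bounded_payoff (pmfs_on A) (pmfs_on B) (payoff f) (Max ((\<lambda>z. \<bar>f z\<bar>) ` (A \<times> B)))"
proof
  show "\<bar>payoff f x y\<bar> \<le> Max ((\<lambda>z. \<bar>f z\<bar>) ` (A \<times> B))" if "x \<in> pmfs_on A" "y \<in> pmfs_on B" for x y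
    using assms by (intro payoff_abs_le[OF assms(1,2) that] Max_ge) auto
qed (simp_all add: assms pmfs_on_nonempty)

text \<open>For each \<open>x\<close>, a near best response under \<open>g\<close> costs no more
  under \<open>f\<close>, so it is a good enough reply there too; the error \<open>e\<close> is
  arbitrary.\<close>

lemma matrix_value_mono:
  assumes fin: "finite A" "finite B" and ne: "A \<noteq> {}" "B \<noteq> {}"
    and le: "\<And>a b. a \<in> A \<Longrightarrow> b \<in> B \<Longrightarrow> f (a, b) \<le> g (a, b)"
  shows "matrix_value A B f \<le> matrix_value A B g"
proof (rule field_le_epsilon)
  fix e :: real assume "e > 0"
  note best = bounded_payoff.ex_near_best_response[OF bounded_payoff_matrix[OF fin ne] this,
      folded matrix_value_def]
  show "matrix_value A B f \<le> matrix_value A B g + e"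
    unfolding matrix_value_def[of A B f]
  proof (rule bounded_payoff.val_le[OF bounded_payoff_matrix[OF fin ne]])
    fix x assume x: "x \<in> pmfs_on A"
    then obtain y where y: "y \<in> pmfs_on B" "payoff g x y \<le> matrix_value A B g + e"
      using best by blast
    then show "\<exists>y\<in>pmfs_on B. payoff f x y \<le> matrix_value A B g + e"
      using payoff_mono[OF fin x y(1), of f g] le by force
  qed
qed

text \<open>A preimage of a distribution on the image set is its pushforward along
  \<open>inv_into A i\<close>, because \<open>i\<close> undoes \<open>inv_into A i\<close> on that
  set.\<close>

lemma pmfs_on_image: "pmfs_on (i ` A) = map_pmf i ` pmfs_on A"
proof (intro equalityI subsetI)
  fix x assume x: "x \<in> pmfs_on (i ` A)"
  have "map_pmf i (map_pmf (inv_into A i) x) = x"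
    using x unfolding pmf.map_comp pmfs_on_def
    by (intro map_pmf_idI) (auto simp: f_inv_into_f)
  moreover have "map_pmf (inv_into A i) x \<in> pmfs_on A"
    using x by (auto simp: pmfs_on_def intro: inv_into_into)
  ultimately show "x \<in> map_pmf i ` pmfs_on A" by (metis imageI)
qed (fastforce simp: pmfs_on_def)

text \<open>Removes the \<open>Inl\<close> tags from the actions of an abstraction, so that its
  rounds at a class and the rounds of the original game have the same action sets.\<close>

lemma matrix_value_image:
  "matrix_value (i ` A) (j ` B) f = matrix_value A B (\<lambda>(a, b). f (i a, j b))"
proof -
  have "payoff f (map_pmf i x) (map_pmf j y) = payoff (\<lambda>(a, b). f (i a, j b)) x y" for x y
    by (simp add: payoff_def map_pair[symmetric] split_def)
  then show ?thesis
    by (simp add: matrix_value_def pmfs_on_image image_image)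
qed

section \<open>The Bellman recursion\<close>

primrec bellman :: "('s, 'a) game_structure \<Rightarrow> ('s \<Rightarrow> real) \<Rightarrow> nat \<Rightarrow> 's \<Rightarrow> real" where
  "bellman G u 0 s = 0"
| "bellman G u (Suc n) s =
     u s + matrix_value (avail1 G s) (avail2 G s) (\<lambda>(a, b). bellman G u n (delta G s a b))"

text \<open>The expected utility of the next \<open>n\<close> steps given the history
  \<open>h\<close>. Recursion over the mixed actions avoids conditional expectations, so histories
  of probability 0 need no special care.\<close>

primrec remaining_utility :: "('s, 'a) game_structure \<Rightarrow> ('s \<Rightarrow> real) \<Rightarrow>
    ('s, 'a) strategy \<Rightarrow> ('s, 'a) strategy \<Rightarrow> nat \<Rightarrow> ('s, 'a) history \<Rightarrow> real" where
  "remaining_utility G u \<sigma>1 \<sigma>2 0 h = 0"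
| "remaining_utility G u \<sigma>1 \<sigma>2 (Suc n) h = u (last_state G h) +
     payoff (\<lambda>(a, b). remaining_utility G u \<sigma>1 \<sigma>2 n (h @ [(last_state G h, a, b)])) (\<sigma>1 h) (\<sigma>2 h)"

lemma last_state_snoc: "last_state G (h @ [(s, a, b)]) = delta G s a b"
  by (simp add: last_state_def step_target_def)

lemma history_prob_snoc:
  "history_prob \<sigma>1 \<sigma>2 (h @ [(s, a, b)]) = history_prob \<sigma>1 \<sigma>2 h * (pmf (\<sigma>1 h) a * pmf (\<sigma>2 h) b)"
  by (auto simp: history_prob_def nth_append intro!: prod.cong)

context concurrent_game
begin

lemma finite_avail:
  assumes "s \<in> states G"
  shows "finite (avail1 G s)" "finite (avail2 G s)"
  using assms avail1_subset avail2_subset finite_actions finite_subset by metis+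

lemma delta_avail:
  "s \<in> states G \<Longrightarrow> a \<in> avail1 G s \<Longrightarrow> b \<in> avail2 G s \<Longrightarrow> delta G s a b \<in> states G"
  using avail1_subset avail2_subset delta_in_states by blast

lemmas avail_last_state =
  finite_avail[OF last_state_in_states]
  avail1_nonempty[OF last_state_in_states] avail2_nonempty[OF last_state_in_states]

section \<open>Strategies and histories, one step at a time\<close>

lemma strategies_pmfs_on:
  "\<sigma>1 \<in> strategies1 G \<Longrightarrow> h \<in> histories G \<Longrightarrow> \<sigma>1 h \<in> pmfs_on (avail1 G (last_state G h))"
  "\<sigma>2 \<in> strategies2 G \<Longrightarrow> h \<in> histories G \<Longrightarrow> \<sigma>2 h \<in> pmfs_on (avail2 G (last_state G h))"
  by (auto simp: strategies1_def strategies2_def pmfs_on_def)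

text \<open>Mixed strategies are constrained at each history separately, so independent local
  choices glue together by the axiom of choice.\<close>

lemma strategies1_extend:
  assumes "\<And>h. h \<in> histories G \<Longrightarrow> \<exists>x\<in>pmfs_on (avail1 G (last_state G h)). Q h x"
  shows "\<exists>\<sigma>\<in>strategies1 G. \<forall>h\<in>histories G. Q h (\<sigma> h)"
proof -
  obtain \<sigma> where "\<forall>h\<in>histories G. \<sigma> h \<in> pmfs_on (avail1 G (last_state G h)) \<and> Q h (\<sigma> h)"
    using assms bchoice[of "histories G" "\<lambda>h x. x \<in> pmfs_on (avail1 G (last_state G h)) \<and> Q h x"]
    by blast
  then show ?thesis by (intro bexI[of _ \<sigma>]) (auto simp: strategies1_def pmfs_on_def)
qed

lemma strategies2_extend:
  assumes "\<And>h. h \<in> histories G \<Longrightarrow> \<exists>x\<in>pmfs_on (avail2 G (last_state G h)). Q h x"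
  shows "\<exists>\<sigma>\<in>strategies2 G. \<forall>h\<in>histories G. Q h (\<sigma> h)"
proof -
  obtain \<sigma> where "\<forall>h\<in>histories G. \<sigma> h \<in> pmfs_on (avail2 G (last_state G h)) \<and> Q h (\<sigma> h)"
    using assms bchoice[of "histories G" "\<lambda>h x. x \<in> pmfs_on (avail2 G (last_state G h)) \<and> Q h x"]
    by blast
  then show ?thesis by (intro bexI[of _ \<sigma>]) (auto simp: strategies2_def pmfs_on_def)
qed

text \<open>Histories are prefixes of infinite plays, so the backward direction has to continue the
  extended list forever. The play built by \<open>chosen_play\<close> does this.\<close>

lemma history_snoc_iff:
  "h @ [(s, a, b)] \<in> histories G \<longleftrightarrow> h \<in> histories G \<and> s = last_state G h \<and>
     a \<in> avail1 G (last_state G h) \<and> b \<in> avail2 G (last_state G h)" (is "?l \<longleftrightarrow> ?r")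
proof
  assume ?l
  then show ?r
    using take_in_histories[of "h @ [(s, a, b)]" G "length h"] history_nth[of "h @ [(s, a, b)]" "length h"]
    by simp
next
  assume ?r
  then have h: "h \<in> histories G" and s: "s = last_state G h"
    and ab: "(a, b) \<in> avail1 G (last_state G h) \<times> avail2 G (last_state G h)" by auto
  define w where "w g = snd ((h @ [(s, a, b)]) ! length g)" for g :: "('s, 'a) history"
  have "choice w (take i h) = snd (h ! i)" if "i < length h" for i
    using history_nth(2)[OF h that] that by (simp add: choice_def w_def nth_append min_def)
  then have eq: "chosen_history w (length h) = h"
    using chosen_history_eq_iff[OF h] by blast
  have "choice w h = (a, b)" using ab by (simp add: choice_def w_def)
  then have "chosen_history w (Suc (length h)) = h @ [(s, a, b)]"
    using eq s by simp
  then show ?l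
    by (metis stake_chosen_play stake_in_histories chosen_play_in_plays)
qed

lemma Nil_in_histories: "[] \<in> histories G"
  using stake_in_histories[OF chosen_play_in_plays, of 0] by simp

section \<open>Expected utility as a recursion over histories\<close>

lemma histories_Suc:
  "{h \<in> histories G. length h = Suc n} =
     (\<lambda>(h, a, b). h @ [(last_state G h, a, b)]) `
       (SIGMA h:{h \<in> histories G. length h = n}. avail1 G (last_state G h) \<times> avail2 G (last_state G h))"
  (is "?l = ?r")
proof (intro equalityI subsetI)
  fix g assume g: "g \<in> ?l"
  then obtain h s a b where eq: "g = h @ [(s, a, b)]"
    by (cases g rule: rev_cases) auto
  then show "g \<in> ?r"
    using g by (auto simp: history_snoc_iff image_iff intro!: bexI[of _ "(h, a, b)"])
qed (auto simp: history_snoc_iff)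

text \<open>The law of total expectation for a single step: unfolding the recursion once at all
  histories of length \<open>k\<close> splits off their stage utility and passes the rest to their
  one-step extensions.\<close>

lemma sum_remaining_utility:
  assumes \<sigma>1: "\<sigma>1 \<in> strategies1 G" and \<sigma>2: "\<sigma>2 \<in> strategies2 G"
  shows "(\<Sum>h | h \<in> histories G \<and> length h = k. history_prob \<sigma>1 \<sigma>2 h * remaining_utility G u \<sigma>1 \<sigma>2 (Suc n) h) =
    (\<Sum>h | h \<in> histories G \<and> length h = k. history_prob \<sigma>1 \<sigma>2 h * u (last_state G h)) +
    (\<Sum>h | h \<in> histories G \<and> length h = Suc k. history_prob \<sigma>1 \<sigma>2 h * remaining_utility G u \<sigma>1 \<sigma>2 n h)"
proof -
  let ?H = "\<lambda>k. {h \<in> histories G. length h = k}"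
  let ?V = "\<lambda>h. avail1 G (last_state G h) \<times> avail2 G (last_state G h)"
  let ?R = "remaining_utility G u \<sigma>1 \<sigma>2"
  have "(\<Sum>h\<in>?H (Suc k). history_prob \<sigma>1 \<sigma>2 h * ?R n h) =
      (\<Sum>(h, a, b)\<in>(SIGMA h:?H k. ?V h). history_prob \<sigma>1 \<sigma>2 h *
         (pmf (\<sigma>1 h) a * pmf (\<sigma>2 h) b * ?R n (h @ [(last_state G h, a, b)])))"
    unfolding histories_Suc
    by (subst sum.reindex) (auto simp: history_prob_snoc inj_on_def mult_ac intro!: sum.cong)
  also have "\<dots> = (\<Sum>h\<in>?H k. \<Sum>(a, b)\<in>?V h. history_prob \<sigma>1 \<sigma>2 h *
         (pmf (\<sigma>1 h) a * pmf (\<sigma>2 h) b * ?R n (h @ [(last_state G h, a, b)])))"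
    by (subst sum.Sigma[symmetric]) (auto simp: finite_histories_length avail_last_state split_def)
  also have "\<dots> = (\<Sum>h\<in>?H k. history_prob \<sigma>1 \<sigma>2 h *
      payoff (\<lambda>(a, b). ?R n (h @ [(last_state G h, a, b)])) (\<sigma>1 h) (\<sigma>2 h))"
    using strategies_pmfs_on(1)[OF \<sigma>1] strategies_pmfs_on(2)[OF \<sigma>2]
    by (intro sum.cong refl, subst payoff_eq_sum[OF avail_last_state(1,2)])
       (auto simp: sum_distrib_left split_def)
  finally show ?thesis
    by (simp add: distrib_left sum.distrib)
qed

text \<open>Almost surely, stage \<open>i\<close> is determined by the history of length
  \<open>i\<close>, and there are finitely many of these. The stage utility is therefore almost
  everywhere a finite combination of cylinder indicators, which gives both integrability and the
  value.\<close>

lemma expectation_snth: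
  assumes \<sigma>1: "\<sigma>1 \<in> strategies1 G" and \<sigma>2: "\<sigma>2 \<in> strategies2 G"
  shows "integrable (play_measure G \<sigma>1 \<sigma>2) (\<lambda>p. u (fst (p !! i)))"
    and "integral\<^sup>L (play_measure G \<sigma>1 \<sigma>2) (\<lambda>p. u (fst (p !! i))) =
      (\<Sum>h | h \<in> histories G \<and> length h = i. history_prob \<sigma>1 \<sigma>2 h * u (last_state G h))"
proof -
  define M where "M = play_measure G \<sigma>1 \<sigma>2"
  have M: "is_play_measure G \<sigma>1 \<sigma>2 M"
    unfolding M_def play_measure_def by (rule theI'[OF ex1_play_measure[OF \<sigma>1 \<sigma>2]])
  then interpret prob_space M by (simp add: is_play_measure_def)
  have sets: "sets M = sets (stream_space (count_space UNIV))"
    using M by (simp add: is_play_measure_def)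
  have space: "space M = UNIV"
    by (simp add: sets_eq_imp_space_eq[OF sets] space_stream_space)
  let ?H = "{h \<in> histories G. length h = i}"
  let ?C = "\<lambda>h. {p. stake (length h) p = h}"
  let ?f = "\<lambda>p. \<Sum>h\<in>?H. u (last_state G h) * indicator (?C h) p"
  have C: "?C h \<in> sets M" for h using sets sets_cylinder by blast
  have fin: "finite ?H" by (rule finite_histories_length)
  have ae: "AE p in M. u (fst (p !! i)) = ?f p"
    using is_play_measure_AE[OF \<sigma>1 \<sigma>2 M]
  proof (rule eventually_mono)
    fix p assume p: "\<forall>n. stake n p \<in> histories G"
    then have g: "stake i p \<in> ?H" by simp
    have "?f p = (\<Sum>h\<in>?H. if h = stake i p then u (last_state G h) else 0)"
      by (intro sum.cong) (auto simp: indicator_def)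
    also have "\<dots> = u (last_state G (stake i p))"
      using g fin by (simp add: sum.delta)
    \<comment> \<open>The prefix of length \<open>Suc i\<close> is used because only a history that
      contains step \<open>i\<close> ties the state recorded there to the steps before it.\<close>
    also have "last_state G (stake i p) = fst (p !! i)"
      using history_nth(1)[OF p[rule_format, of "Suc i"], of i]
      by (simp add: take_stake stake_nth del: stake.simps)
    finally show "u (fst (p !! i)) = ?f p" by simp
  qed
  have int: "integrable M (\<lambda>p. u (last_state G h) * indicator (?C h) p)" for h
    using C by (intro integrable_mult_right) (simp add: integrable_indicator_iff emeasure_eq_measure)
  have "(\<lambda>p. p !! i) \<in> measurable M (count_space UNIV)"
    unfolding measurable_cong_sets[OF sets refl] by (rule measurable_snth)
  then have "(\<lambda>x. u (fst x)) \<circ> (\<lambda>p. p !! i) \<in> borel_measurable M"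
    by (rule measurable_comp) simp
  then have meas: "(\<lambda>p. u (fst (p !! i))) \<in> borel_measurable M"
    by (simp add: comp_def)
  have intf: "integrable M ?f" using int by (rule Bochner_Integration.integrable_sum)
  show "integrable (play_measure G \<sigma>1 \<sigma>2) (\<lambda>p. u (fst (p !! i)))"
    using integrable_cong_AE[OF meas borel_measurable_integrable[OF intf] ae] intf
    by (simp add: M_def)
  have "integral\<^sup>L M (\<lambda>p. u (fst (p !! i))) = integral\<^sup>L M ?f"
    by (rule integral_cong_AE[OF meas borel_measurable_integrable[OF intf] ae])
  also have "\<dots> = (\<Sum>h\<in>?H. u (last_state G h) * measure M (?C h))"
    using C by (subst Bochner_Integration.integral_sum[OF int]) (simp add: space)
  also have "\<dots> = (\<Sum>h\<in>?H. history_prob \<sigma>1 \<sigma>2 h * u (last_state G h))"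
    using M by (intro sum.cong) (auto simp: is_play_measure_def)
  finally show "integral\<^sup>L (play_measure G \<sigma>1 \<sigma>2) (\<lambda>p. u (fst (p !! i))) =
      (\<Sum>h | h \<in> histories G \<and> length h = i. history_prob \<sigma>1 \<sigma>2 h * u (last_state G h))"
    by (simp add: M_def)
qed

lemma expected_utility_eq_remaining_utility:
  assumes \<sigma>1: "\<sigma>1 \<in> strategies1 G" and \<sigma>2: "\<sigma>2 \<in> strategies2 G"
  shows "expected_utility G u L \<sigma>1 \<sigma>2 = remaining_utility G u \<sigma>1 \<sigma>2 L []"
proof -
  let ?H = "\<lambda>k. {h \<in> histories G. length h = k}"
  let ?S = "\<lambda>k f. \<Sum>h\<in>?H k. history_prob \<sigma>1 \<sigma>2 h * f h"
  let ?R = "remaining_utility G u \<sigma>1 \<sigma>2"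
  \<comment> \<open>Invariant: stages below \<open>k\<close> are summed explicitly and the other
    \<open>n\<close> are still hidden in the recursion. At \<open>k = 0\<close> this is the
    recursion at the empty history, at \<open>k = L\<close> the sum of the expected stage
    utilities.\<close>
  have "(\<Sum>i<k. ?S i (\<lambda>h. u (last_state G h))) + ?S k (?R n) = ?R L []" if "k + n = L" for k n
    using that
  proof (induction k arbitrary: n)
    case 0
    have "?H 0 = {[]}" using Nil_in_histories by auto
    then show ?case using 0 by (simp add: history_prob_def)
  next
    case (Suc k)
    then show ?case
      using Suc.IH[of "Suc n"] sum_remaining_utility[OF \<sigma>1 \<sigma>2, where k=k and u=u and n=n] by simp
  qed
  from this[of L 0] show ?thesis
    unfolding expected_utility_def prefix_utility_def
    by (simp add: Bochner_Integration.integral_sum expectation_snth[OF \<sigma>1 \<sigma>2])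
qed

section \<open>The value of the whole game\<close>

lemma remaining_utility_abs_le:
  assumes \<sigma>1: "\<sigma>1 \<in> strategies1 G" and \<sigma>2: "\<sigma>2 \<in> strategies2 G" and h: "h \<in> histories G"
  shows "\<bar>remaining_utility G u \<sigma>1 \<sigma>2 n h\<bar> \<le> real n * Max ((\<lambda>s. \<bar>u s\<bar>) ` states G)"
  using h
proof (induction n arbitrary: h)
  case (Suc n)
  let ?B = "Max ((\<lambda>s. \<bar>u s\<bar>) ` states G)"
  note st = strategies_pmfs_on(1)[OF \<sigma>1 Suc.prems] strategies_pmfs_on(2)[OF \<sigma>2 Suc.prems]
  have "\<bar>u (last_state G h)\<bar> \<le> ?B"
    using finite_states last_state_in_states[OF Suc.prems] by (intro Max_ge) auto
  moreover have "\<bar>payoff (\<lambda>(a, b). remaining_utility G u \<sigma>1 \<sigma>2 n (h @ [(last_state G h, a, b)]))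
      (\<sigma>1 h) (\<sigma>2 h)\<bar> \<le> real n * ?B"
    using Suc by (intro payoff_abs_le[OF avail_last_state(1,2)[OF Suc.prems] st])
      (simp add: history_snoc_iff)
  ultimately show ?case by (simp add: algebra_simps)
qed simp

lemma bounded_payoff_game:
  "bounded_payoff (strategies1 G) (strategies2 G) (expected_utility G u L)
     (real L * Max ((\<lambda>s. \<bar>u s\<bar>) ` states G))"
proof
  \<comment> \<open>Nonemptiness of the strategy sets is the gluing lemma for the trivial
    property.\<close>
  have ex: "\<exists>x\<in>pmfs_on A. True" if "A \<noteq> {}" for A :: "'a set"
    using pmfs_on_nonempty[OF that] by blast
  have "\<exists>\<sigma>\<in>strategies1 G. \<forall>h\<in>histories G. True"
    by (intro strategies1_extend ex avail_last_state)
  then show "strategies1 G \<noteq> {}" by blast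
  have "\<exists>\<sigma>\<in>strategies2 G. \<forall>h\<in>histories G. True"
    by (intro strategies2_extend ex avail_last_state)
  then show "strategies2 G \<noteq> {}" by blast
qed (simp add: expected_utility_eq_remaining_utility remaining_utility_abs_le Nil_in_histories)

theorem finite_horizon_value_eq_bellman:
  "finite_horizon_value G u L = bellman G u L (start G)"
proof -
  let ?A = "\<lambda>h. avail1 G (last_state G h)" and ?B = "\<lambda>h. avail2 G (last_state G h)"
  let ?next = "\<lambda>n h. (\<lambda>(a, b). bellman G u n (delta G (last_state G h) a b))"
  let ?m = "\<lambda>n h. matrix_value (?A h) (?B h) (?next n h)"
  let ?R = "remaining_utility G u"
  have start: "last_state G [] = start G" by (simp add: last_state_def)
  have bpm: "bounded_payoff (pmfs_on (?A h)) (pmfs_on (?B h)) (payoff f)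
      (Max ((\<lambda>z. \<bar>f z\<bar>) ` (?A h \<times> ?B h)))" if "h \<in> histories G" for h and f :: "'a \<times> 'a \<Rightarrow> real"
    using bounded_payoff_matrix avail_last_state[OF that] by blast
  have lower: "\<exists>\<sigma>1\<in>strategies1 G. \<forall>\<sigma>2\<in>strategies2 G.
      bellman G u L (start G) - real L * e \<le> expected_utility G u L \<sigma>1 \<sigma>2" if e: "e > 0" for e
  proof -
    \<comment> \<open>After \<open>h\<close> and the current step, \<open>L - Suc (length h)\<close>
      steps are left. Histories of length \<open>L\<close> or more get the index 0 by truncated
      subtraction and are never reached within the horizon.\<close>
    have "\<exists>x\<in>pmfs_on (?A h). \<forall>y\<in>pmfs_on (?B h).
        ?m (L - Suc (length h)) h - e \<le> payoff (?next (L - Suc (length h)) h) x y"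
      if "h \<in> histories G" for h
      using bounded_payoff.ex_near_optimal[OF bpm[OF that] e, folded matrix_value_def] .
    from strategies1_extend[OF this] obtain \<sigma>1 where \<sigma>1: "\<sigma>1 \<in> strategies1 G"
      and opt: "\<And>h y. h \<in> histories G \<Longrightarrow> y \<in> pmfs_on (?B h) \<Longrightarrow>
        ?m (L - Suc (length h)) h - e \<le> payoff (?next (L - Suc (length h)) h) (\<sigma>1 h) y"
      by blast
    \<comment> \<open>Backward induction that loses one \<open>e\<close> per remaining step. Since
      \<sigma>1 was fixed before \<sigma>2, \<open>opt\<close> applies to any mixed action that
      \<sigma>2 takes at \<open>h\<close>.\<close>
    have *: "bellman G u n (last_state G h) - real n * e \<le> ?R \<sigma>1 \<sigma>2 n h"
      if \<sigma>2: "\<sigma>2 \<in> strategies2 G" and "h \<in> histories G" "n + length h = L" for \<sigma>2 n h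
      using that(2,3)
    proof (induction n arbitrary: h)
      case (Suc n)
      note st = strategies_pmfs_on(1)[OF \<sigma>1 Suc.prems(1)] strategies_pmfs_on(2)[OF \<sigma>2 Suc.prems(1)]
      note fin = avail_last_state(1,2)[OF Suc.prems(1)]
      have n: "L - Suc (length h) = n" using Suc.prems(2) by simp
      have "?m n h - e \<le> payoff (?next n h) (\<sigma>1 h) (\<sigma>2 h)"
        using opt[OF Suc.prems(1) st(2)] unfolding n .
      also have "\<dots> \<le> payoff (\<lambda>z. (\<lambda>(a, b). ?R \<sigma>1 \<sigma>2 n (h @ [(last_state G h, a, b)])) z + real n * e)
          (\<sigma>1 h) (\<sigma>2 h)"
      proof (rule payoff_mono[OF fin st], simp only: prod.case)
        fix a b assume ab: "a \<in> ?A h" "b \<in> ?B h"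
        have "h @ [(last_state G h, a, b)] \<in> histories G"
          using Suc.prems(1) ab by (simp add: history_snoc_iff)
        from Suc.IH[OF this] Suc.prems(2)
        show "bellman G u n (delta G (last_state G h) a b) \<le>
            ?R \<sigma>1 \<sigma>2 n (h @ [(last_state G h, a, b)]) + real n * e"
          by (simp add: last_state_snoc)
      qed
      also have "\<dots> = payoff (\<lambda>(a, b). ?R \<sigma>1 \<sigma>2 n (h @ [(last_state G h, a, b)])) (\<sigma>1 h) (\<sigma>2 h) + real n * e"
        by (rule payoff_add_const[OF fin st])
      finally show ?case by (simp add: algebra_simps)
    qed simp
    show ?thesis
    proof (intro bexI[OF _ \<sigma>1] ballI)
      fix \<sigma>2 assume \<sigma>2: "\<sigma>2 \<in> strategies2 G"
      show "bellman G u L (start G) - real L * e \<le> expected_utility G u L \<sigma>1 \<sigma>2"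
        using *[OF \<sigma>2 Nil_in_histories, of L]
        by (simp add: start expected_utility_eq_remaining_utility[OF \<sigma>1 \<sigma>2])
    qed
  qed
  have upper: "\<exists>\<sigma>2\<in>strategies2 G. expected_utility G u L \<sigma>1 \<sigma>2 \<le> bellman G u L (start G) + real L * e"
    if e: "e > 0" and \<sigma>1: "\<sigma>1 \<in> strategies1 G" for e \<sigma>1
  proof -
    \<comment> \<open>Here \<sigma>1 is given, so each reply is chosen against the known mixed
      action of player 1 at \<open>h\<close>.\<close>
    have "\<exists>y\<in>pmfs_on (?B h).
        payoff (?next (L - Suc (length h)) h) (\<sigma>1 h) y \<le> ?m (L - Suc (length h)) h + e"
      if "h \<in> histories G" for h
      using bounded_payoff.ex_near_best_response[OF bpm[OF that] e strategies_pmfs_on(1)[OF \<sigma>1 that],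
          folded matrix_value_def] .
    from strategies2_extend[OF this] obtain \<sigma>2 where \<sigma>2: "\<sigma>2 \<in> strategies2 G"
      and opt: "\<And>h. h \<in> histories G \<Longrightarrow>
        payoff (?next (L - Suc (length h)) h) (\<sigma>1 h) (\<sigma>2 h) \<le> ?m (L - Suc (length h)) h + e"
      by blast
    have *: "?R \<sigma>1 \<sigma>2 n h \<le> bellman G u n (last_state G h) + real n * e"
      if "h \<in> histories G" "n + length h = L" for n h
      using that
    proof (induction n arbitrary: h)
      case (Suc n)
      note st = strategies_pmfs_on(1)[OF \<sigma>1 Suc.prems(1)] strategies_pmfs_on(2)[OF \<sigma>2 Suc.prems(1)]
      note fin = avail_last_state(1,2)[OF Suc.prems(1)]
      have n: "L - Suc (length h) = n" using Suc.prems(2) by simp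
      have "payoff (\<lambda>(a, b). ?R \<sigma>1 \<sigma>2 n (h @ [(last_state G h, a, b)])) (\<sigma>1 h) (\<sigma>2 h) \<le>
          payoff (\<lambda>z. ?next n h z + real n * e) (\<sigma>1 h) (\<sigma>2 h)"
      proof (rule payoff_mono[OF fin st], simp only: prod.case)
        fix a b assume ab: "a \<in> ?A h" "b \<in> ?B h"
        have "h @ [(last_state G h, a, b)] \<in> histories G"
          using Suc.prems(1) ab by (simp add: history_snoc_iff)
        from Suc.IH[OF this] Suc.prems(2)
        show "?R \<sigma>1 \<sigma>2 n (h @ [(last_state G h, a, b)]) \<le>
            bellman G u n (delta G (last_state G h) a b) + real n * e"
          by (simp add: last_state_snoc)
      qed
      also have "\<dots> = payoff (?next n h) (\<sigma>1 h) (\<sigma>2 h) + real n * e"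
        by (rule payoff_add_const[OF fin st])
      also have "payoff (?next n h) (\<sigma>1 h) (\<sigma>2 h) \<le> ?m n h + e"
        using opt[OF Suc.prems(1)] unfolding n .
      finally show ?case by (simp add: algebra_simps)
    qed simp
    show ?thesis
      using *[OF Nil_in_histories, of L]
      by (intro bexI[OF _ \<sigma>2]) (simp add: start expected_utility_eq_remaining_utility[OF \<sigma>1 \<sigma>2])
  qed
  \<comment> \<open>Dividing by \<open>real L + 1\<close> also covers \<open>L = 0\<close>.\<close>
  have slack: "\<exists>d>0. real L * d \<le> e" if "e > 0" for e
    using that by (intro exI[of _ "e / (real L + 1)"]) (simp add: field_simps)
  show ?thesis
  proof (rule antisym)
    show "finite_horizon_value G u L \<le> bellman G u L (start G)"
    proof (rule field_le_epsilon)
      fix e :: real assume "e > 0"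
      then obtain d where "d > 0" "real L * d \<le> e" using slack by blast
      then show "finite_horizon_value G u L \<le> bellman G u L (start G) + e"
        unfolding finite_horizon_value_def
        using upper[of d] by (intro bounded_payoff.val_le[OF bounded_payoff_game]) force
    qed
    show "bellman G u L (start G) \<le> finite_horizon_value G u L"
    proof (rule field_le_epsilon)
      fix e :: real assume "e > 0"
      then obtain d where d: "d > 0" "real L * d \<le> e" using slack by blast
      then obtain \<sigma>1 where "\<sigma>1 \<in> strategies1 G" "\<forall>\<sigma>2\<in>strategies2 G.
          bellman G u L (start G) - real L * d \<le> expected_utility G u L \<sigma>1 \<sigma>2"
        using lower by blast
      then have "bellman G u L (start G) - real L * d \<le> finite_horizon_value G u L"
        unfolding finite_horizon_value_def
        by (intro bounded_payoff.val_ge[OF bounded_payoff_game]) auto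
      then show "bellman G u L (start G) \<le> finite_horizon_value G u L + e"
        using d by linarith
    qed
  qed
qed

end

section \<open>Soundness of the abstractions\<close>

context concurrent_game
begin

text \<open>One step of \<open>G\<close> corresponds to two of \<open>H\<close>: a class, where the
  same actions are available and the utility is the minimum, then a dummy state of utility 0, where
  player 2 can at least move to the class of the true successor. The induction covers all classes
  and their members at once, since that successor may lie in any class.\<close>

lemma lower_abstraction_bellman_le:
  assumes part: "partition_on (states G) P" and low: "lower_abstraction G u P H v"
    and "\<pi> \<in> P" "s \<in> \<pi>"
  shows "bellman H v (2 * n) (Inl \<pi>) \<le> bellman G u n s"
  using assms(3,4)
proof (induction n arbitrary: \<pi> s)
  case (Suc n)
  have com: "abstraction_common G P H" using low by (simp add: lower_abstraction_def)
  interpret H: concurrent_game H using com by (simp add: abstraction_common_def)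
  have s: "s \<in> states G" using Suc.prems partition_onD1[OF part] by blast
  have av: "avail1 H (Inl \<pi>) = Inl ` avail1 G s" "avail2 H (Inl \<pi>) = Inl ` avail2 G s"
    and dl: "\<And>a b. a \<in> avail1 G s \<Longrightarrow> b \<in> avail2 G s \<Longrightarrow> delta H (Inl \<pi>) (Inl a) (Inl b) = Inr (\<pi>, a, b)"
    using com Suc.prems by (auto simp: abstraction_common_def)
  have dummy: "bellman H v (Suc (2 * n)) (Inr (\<pi>, a, b)) \<le> bellman G u n (delta G s a b)"
    if a: "a \<in> avail1 G s" and b: "b \<in> avail2 G s" for a b
  proof -
    let ?d = "Inr (\<pi>, a, b) :: ('s, 'a) abs_state"
    have ab: "a \<in> actions G" "b \<in> actions G" using avail1_subset[OF s] avail2_subset[OF s] a b by auto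
    obtain \<pi>' where \<pi>': "\<pi>' \<in> P" "delta G s a b \<in> \<pi>'"
      using delta_avail[OF s a b] partition_onD1[OF part] by blast
    have succ: "\<pi>' \<in> successor_classes G P \<pi> a b"
      using \<pi>' Suc.prems by (auto simp: successor_classes_def)
    from low Suc.prems(1) ab obtain c where
      c: "avail1 H ?d = {c}" and A2: "avail2 H ?d = Inr ` successor_classes G P \<pi> a b"
      and dd: "\<And>\<pi>'. \<pi>' \<in> successor_classes G P \<pi> a b \<Longrightarrow> delta H ?d c (Inr \<pi>') = Inl \<pi>'"
      and v0: "v ?d = 0"
      unfolding lower_abstraction_def by (metis singletonI)
    have d: "?d \<in> states H" using com Suc.prems ab by (auto simp: abstraction_common_def)
    have "matrix_value (avail1 H ?d) (avail2 H ?d) (\<lambda>(x, y). bellman H v (2 * n) (delta H ?d x y)) \<le>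
        bellman H v (2 * n) (Inl \<pi>')"
      unfolding matrix_value_def
    proof (rule bounded_payoff.val_le[OF bounded_payoff_matrix[OF H.finite_avail[OF d]
              H.avail1_nonempty[OF d] H.avail2_nonempty[OF d]]])
      fix x assume "x \<in> pmfs_on (avail1 H ?d)"
      \<comment> \<open>Player 1 is idle at a dummy state and has a single mixed action. The reply
        of player 2 is the point mass on the class of the true successor.\<close>
      then have "x = return_pmf c" by (simp add: c pmfs_on_def set_pmf_subset_singleton)
      then show "\<exists>y\<in>pmfs_on (avail2 H ?d).
          payoff (\<lambda>(x, y). bellman H v (2 * n) (delta H ?d x y)) x y \<le> bellman H v (2 * n) (Inl \<pi>')"
        using succ by (intro bexI[of _ "return_pmf (Inr \<pi>')"])
          (auto simp: payoff_def pair_return_pmf1 dd A2 pmfs_on_def)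
    qed
    also have "\<dots> \<le> bellman G u n (delta G s a b)" using Suc.IH[OF \<pi>'] .
    finally show ?thesis by (simp add: v0)
  qed
  \<comment> \<open>\<open>Min\<close> is a lower bound only on finite sets.\<close>
  have "finite \<pi>"
    using Suc.prems partition_onD1[OF part] finite_states by (metis Sup_upper finite_subset)
  then have "v (Inl \<pi>) \<le> u s"
    using low Suc.prems by (auto simp: lower_abstraction_def)
  \<comment> \<open>With the \<open>Inl\<close> tags removed, both rounds are matrix games on the
    actions available at \<open>s\<close>, and \<open>dummy\<close> compares them entry by
    entry.\<close>
  moreover have "matrix_value (avail1 H (Inl \<pi>)) (avail2 H (Inl \<pi>))
      (\<lambda>(x, y). bellman H v (Suc (2 * n)) (delta H (Inl \<pi>) x y)) \<le>
    matrix_value (avail1 G s) (avail2 G s) (\<lambda>(a, b). bellman G u n (delta G s a b))"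
    unfolding av matrix_value_image using dummy
    by (intro matrix_value_mono finite_avail avail1_nonempty avail2_nonempty s)
       (simp add: dl del: bellman.simps)
  ultimately have "bellman H v (Suc (Suc (2 * n))) (Inl \<pi>) \<le> bellman G u (Suc n) s"
    unfolding bellman.simps(2)[of H v "Suc (2 * n)"] bellman.simps(2)[of G] by linarith
  then show ?case by simp
qed simp

text \<open>The mirror image: the class utility is a maximum and player 1 resolves the dummy state.
  The pure move to the class of the true successor bounds the value of the dummy state from below,
  because player 2 has only one mixed action there.\<close>

lemma upper_abstraction_bellman_ge:
  assumes part: "partition_on (states G) P" and upp: "upper_abstraction G u P H v"
    and "\<pi> \<in> P" "s \<in> \<pi>"
  shows "bellman G u n s \<le> bellman H v (2 * n) (Inl \<pi>)"
  using assms(3,4)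
proof (induction n arbitrary: \<pi> s)
  case (Suc n)
  have com: "abstraction_common G P H" using upp by (simp add: upper_abstraction_def)
  interpret H: concurrent_game H using com by (simp add: abstraction_common_def)
  have s: "s \<in> states G" using Suc.prems partition_onD1[OF part] by blast
  have av: "avail1 H (Inl \<pi>) = Inl ` avail1 G s" "avail2 H (Inl \<pi>) = Inl ` avail2 G s"
    and dl: "\<And>a b. a \<in> avail1 G s \<Longrightarrow> b \<in> avail2 G s \<Longrightarrow> delta H (Inl \<pi>) (Inl a) (Inl b) = Inr (\<pi>, a, b)"
    using com Suc.prems by (auto simp: abstraction_common_def)
  have dummy: "bellman G u n (delta G s a b) \<le> bellman H v (Suc (2 * n)) (Inr (\<pi>, a, b))"
    if a: "a \<in> avail1 G s" and b: "b \<in> avail2 G s" for a b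
  proof -
    let ?d = "Inr (\<pi>, a, b) :: ('s, 'a) abs_state"
    have ab: "a \<in> actions G" "b \<in> actions G" using avail1_subset[OF s] avail2_subset[OF s] a b by auto
    obtain \<pi>' where \<pi>': "\<pi>' \<in> P" "delta G s a b \<in> \<pi>'"
      using delta_avail[OF s a b] partition_onD1[OF part] by blast
    have succ: "\<pi>' \<in> successor_classes G P \<pi> a b"
      using \<pi>' Suc.prems by (auto simp: successor_classes_def)
    from upp Suc.prems(1) ab obtain c where
      c: "avail2 H ?d = {c}" and A1: "avail1 H ?d = Inr ` successor_classes G P \<pi> a b"
      and dd: "\<And>\<pi>'. \<pi>' \<in> successor_classes G P \<pi> a b \<Longrightarrow> delta H ?d (Inr \<pi>') c = Inl \<pi>'"
      and v0: "v ?d = 0"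
      unfolding upper_abstraction_def by (metis singletonI)
    have d: "?d \<in> states H" using com Suc.prems ab by (auto simp: abstraction_common_def)
    have "bellman G u n (delta G s a b) \<le> bellman H v (2 * n) (Inl \<pi>')" using Suc.IH[OF \<pi>'] .
    also have "\<dots> \<le> matrix_value (avail1 H ?d) (avail2 H ?d)
        (\<lambda>(x, y). bellman H v (2 * n) (delta H ?d x y))"
      unfolding matrix_value_def
    proof (rule bounded_payoff.val_ge[OF bounded_payoff_matrix[OF H.finite_avail[OF d]
              H.avail1_nonempty[OF d] H.avail2_nonempty[OF d]]])
      show "return_pmf (Inr \<pi>') \<in> pmfs_on (avail1 H ?d)"
        using succ by (simp add: A1 return_pmf_in_pmfs_on)
      fix y assume "y \<in> pmfs_on (avail2 H ?d)"
      then have "y = return_pmf c" by (simp add: c pmfs_on_def set_pmf_subset_singleton)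
      then show "bellman H v (2 * n) (Inl \<pi>') \<le>
          payoff (\<lambda>(x, y). bellman H v (2 * n) (delta H ?d x y)) (return_pmf (Inr \<pi>')) y"
        using succ by (simp add: payoff_def pair_return_pmf1 dd)
    qed
    finally show ?thesis by (simp add: v0)
  qed
  have "finite \<pi>"
    using Suc.prems partition_onD1[OF part] finite_states by (metis Sup_upper finite_subset)
  then have "u s \<le> v (Inl \<pi>)"
    using upp Suc.prems by (auto simp: upper_abstraction_def)
  moreover have "matrix_value (avail1 G s) (avail2 G s) (\<lambda>(a, b). bellman G u n (delta G s a b)) \<le>
    matrix_value (avail1 H (Inl \<pi>)) (avail2 H (Inl \<pi>))
      (\<lambda>(x, y). bellman H v (Suc (2 * n)) (delta H (Inl \<pi>) x y))"
    unfolding av matrix_value_image using dummy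
    by (intro matrix_value_mono finite_avail avail1_nonempty avail2_nonempty s)
       (simp add: dl del: bellman.simps)
  ultimately have "bellman G u (Suc n) s \<le> bellman H v (Suc (Suc (2 * n))) (Inl \<pi>)"
    unfolding bellman.simps(2)[of H v "Suc (2 * n)"] bellman.simps(2)[of G] by linarith
  then show ?case by simp
qed simp

end

theorem theorem2:
  fixes G :: "('s, 'a) game_structure" and u :: "'s \<Rightarrow> real" and P :: "'s set set"
    and Gl Gu :: "('s, 'a) abs_game" and ul uu :: "('s, 'a) abs_state \<Rightarrow> real"
  assumes "concurrent_game G"
    and "partition_on (states G) P"
    and "abstractable G P"
    and "lower_abstraction G u P Gl ul"
    and "upper_abstraction G u P Gu uu"
  shows "\<forall>L::nat. finite_horizon_value Gl ul (2 * L) \<le> finite_horizon_value G u L \<and>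
           finite_horizon_value G u L \<le> finite_horizon_value Gu uu (2 * L)"
proof -
  interpret G: concurrent_game G by fact
  have com: "abstraction_common G P Gl" "abstraction_common G P Gu"
    using assms(4,5) by (simp_all add: lower_abstraction_def upper_abstraction_def)
  interpret Gl: concurrent_game Gl using com(1) by (simp add: abstraction_common_def)
  interpret Gu: concurrent_game Gu using com(2) by (simp add: abstraction_common_def)
  \<comment> \<open>Both abstract start states are classes containing \<open>start G\<close>, so the
    two comparisons can be applied at \<open>start G\<close> itself.\<close>
  obtain \<pi>l where l: "\<pi>l \<in> P" "start G \<in> \<pi>l" "start Gl = Inl \<pi>l"
    using com(1) by (auto simp: abstraction_common_def)
  obtain \<pi>u where u: "\<pi>u \<in> P" "start G \<in> \<pi>u" "start Gu = Inl \<pi>u"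
    using com(2) by (auto simp: abstraction_common_def)
  show ?thesis
    unfolding G.finite_horizon_value_eq_bellman Gl.finite_horizon_value_eq_bellman
      Gu.finite_horizon_value_eq_bellman l(3) u(3)
    using G.lower_abstraction_bellman_le[OF assms(2,4) l(1,2)]
      G.upper_abstraction_bellman_ge[OF assms(2,5) u(1,2)] by blast
qed

end
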